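(* Let $k$ be a field with $\operatorname{char} k\neq 2$ and let $n\geq 2$ be an even integer. Let $\mathcal{A}=\{a_{ij}\in k\mid 1\le i<j\le n\}$ and $\mathcal{A}'=\{a'_{ij}\in k\mid 1\le i<j\le n\}$ be two sets of scalars in $k$, and set $a_{ij}=a_{ji}$ and $a'_{ij}=a'_{ji}$ if $i>j$. Then $V_n(\mathcal{A})\cong V_n(\mathcal{A}')$ as $k$-algebras if and only if there are a permutation $\sigma\in S_n$ and nonzero scalars $\lambda_i\in k$ for $i=1,\dots,n$ such that $a'_{ij}=\lambda_i\lambda_j a_{\sigma(i)\sigma(j)}$ for all $i\neq j$.
   Context: For a set of scalars $\mathcal{A}=\{a_{ij}\in k\mid 1\le i<j\le n\}$, $V_n(\mathcal{A})$ denotes the $k$-algebra generated by $x_1,\dots,x_n$ subject to the relations $x_ix_j+x_jx_i=a_{ij}$ for all $1\le i<j\le n$. *)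

theory Defs
  imports
    "HOL-Combinatorics.Permutations"
    "HOL-Library.Poly_Mapping"
    "HOL-Algebra.Module"
    "HOL-Algebra.QuotRing"
begin

section \<open>Free associative algebras\<close>

text \<open>
  The noncommutative monomials in \<open>x\<^sub>1, x\<^sub>2, \<dots>\<close> are finite words in the indices, multiplied by
  concatenation. Making this monoid an additive one lets the convolution product of
  \<^theory>\<open>HOL-Library.Poly_Mapping\<close> turn the finitely supported functions on words into the free
  algebra.
\<close>

datatype word = Word (letters: "nat list")

instantiation word :: monoid_add
begin

definition zero_word :: word where
  "0 = Word []"

definition plus_word :: "word \<Rightarrow> word \<Rightarrow> word" where
  "u + v = Word (letters u @ letters v)"

instance
  by standard (simp_all add: zero_word_def plus_word_def)

end

text \<open>
  The free algebra \<open>k\<langle>x\<^sub>1,\<dots>,x\<^sub>n\<rangle>\<close>. The scalar field \<open>k\<close> is the whole type.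
\<close>

definition free_algebra :: "nat \<Rightarrow> ('k::field, word \<Rightarrow>\<^sub>0 'k) module" where
  "free_algebra n =
     \<lparr>carrier = {p. \<forall>w \<in> Poly_Mapping.keys p. set (letters w) \<subseteq> {1..n}},
      mult = (*), one = 1, zero = 0, add = (+),
      smult = (\<lambda>c. Poly_Mapping.map ((*) c))\<rparr>"

definition gen :: "nat \<Rightarrow> (word \<Rightarrow>\<^sub>0 'k::field)" where
  "gen i = Poly_Mapping.single (Word [i]) 1"

definition scalar :: "'k::field \<Rightarrow> (word \<Rightarrow>\<^sub>0 'k)" where
  "scalar c = Poly_Mapping.single 0 c"


section \<open>Quotient algebras and algebra isomorphisms\<close>

text \<open>
  The ring structure is that of \<^const>\<open>FactRing\<close>, by two-sided ideals. As in \<^const>\<open>rcoset_mult\<close>,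
  the union below is over cosets that all coincide when \<open>I\<close> is an ideal stable under scalars.
\<close>

definition quot_algebra :: "('k, 'a) module \<Rightarrow> 'a set \<Rightarrow> ('k, 'a set) module" where
  "quot_algebra A I =
     \<lparr>carrier = carrier (A Quot I),
      mult = mult (A Quot I), one = one (A Quot I),
      zero = zero (A Quot I), add = add (A Quot I),
      smult = (\<lambda>c X. \<Union>x\<in>X. I +>\<^bsub>A\<^esub> (c \<odot>\<^bsub>A\<^esub> x))\<rparr>"

definition algebra_iso :: "('k, 'a) module \<Rightarrow> ('k, 'b) module \<Rightarrow> ('a \<Rightarrow> 'b) set" where
  "algebra_iso A B =
     {h \<in> ring_iso A B. \<forall>c. \<forall>x \<in> carrier A. h (c \<odot>\<^bsub>A\<^esub> x) = c \<odot>\<^bsub>B\<^esub> h x}"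

definition algebra_isomorphic :: "('k, 'a) module \<Rightarrow> ('k, 'b) module \<Rightarrow> bool" where
  "algebra_isomorphic A B \<longleftrightarrow> algebra_iso A B \<noteq> {}"


section \<open>The algebras \<open>V\<^sub>n(\<A>)\<close>\<close>

text \<open>Only the values \<open>a i j\<close> with \<open>1 \<le> i < j \<le> n\<close> enter the relations.\<close>

definition V_relations :: "nat \<Rightarrow> (nat \<Rightarrow> nat \<Rightarrow> 'k::field) \<Rightarrow> (word \<Rightarrow>\<^sub>0 'k) set" where
  "V_relations n a =
     {gen i * gen j + gen j * gen i - scalar (a i j) | i j. 1 \<le> i \<and> i < j \<and> j \<le> n}"

definition V_algebra :: "nat \<Rightarrow> (nat \<Rightarrow> nat \<Rightarrow> 'k::field) \<Rightarrow> ('k, (word \<Rightarrow>\<^sub>0 'k) set) module" where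
  "V_algebra n a = quot_algebra (free_algebra n) (genideal (free_algebra n) (V_relations n a))"


section \<open>Well-definedness\<close>

lemma keys_mult_letters:
  fixes p q :: "word \<Rightarrow>\<^sub>0 'k::field"
  assumes "\<forall>w \<in> Poly_Mapping.keys p. set (letters w) \<subseteq> S" "\<forall>w \<in> Poly_Mapping.keys q. set (letters w) \<subseteq> S"
  shows "\<forall>w \<in> Poly_Mapping.keys (p * q). set (letters w) \<subseteq> S"
proof
  fix w assume "w \<in> Poly_Mapping.keys (p * q)"
  then obtain u v where "u \<in> Poly_Mapping.keys p" "v \<in> Poly_Mapping.keys q" "w = u + v"
    using Poly_Mapping.keys_mult[of p q] by blast
  with assms show "set (letters w) \<subseteq> S"
    by (auto simp: plus_word_def)
qed

lemma ring_free_algebra: "ring (free_algebra n :: ('k::field, word \<Rightarrow>\<^sub>0 'k) module)"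
proof (rule ringI)
  let ?F = "free_algebra n :: ('k, word \<Rightarrow>\<^sub>0 'k) module"
  have uminus: "- p \<in> carrier ?F" if "p \<in> carrier ?F" for p
    using that by (simp add: free_algebra_def)
  show "abelian_group ?F"
  proof (rule abelian_groupI)
    fix p q assume "p \<in> carrier ?F" "q \<in> carrier ?F"
    then show "p \<oplus>\<^bsub>?F\<^esub> q \<in> carrier ?F"
      using Poly_Mapping.keys_add[of p q] by (auto simp: free_algebra_def)
  next
    fix p assume "p \<in> carrier ?F"
    with uminus show "\<exists>q \<in> carrier ?F. q \<oplus>\<^bsub>?F\<^esub> p = \<zero>\<^bsub>?F\<^esub>"
      by (intro bexI[of _ "- p"]) (auto simp: free_algebra_def)
  qed (simp_all add: free_algebra_def ac_simps)
  show "Group.monoid ?F"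
  proof (rule monoidI)
    fix p q assume "p \<in> carrier ?F" "q \<in> carrier ?F"
    then show "p \<otimes>\<^bsub>?F\<^esub> q \<in> carrier ?F"
      using keys_mult_letters[of p "{1..n}" q] by (simp add: free_algebra_def)
  qed (simp_all add: free_algebra_def mult.assoc zero_word_def)
qed (simp_all add: free_algebra_def distrib_left distrib_right)

lemma V_relations_subset: "V_relations n a \<subseteq> carrier (free_algebra n)"
proof -
  let ?F = "free_algebra n :: ('a, word \<Rightarrow>\<^sub>0 'a) module"
  interpret ring ?F by (rule ring_free_algebra)
  have gen: "gen i \<in> carrier ?F" if "1 \<le> i" "i \<le> n" for i
    using that by (auto simp: free_algebra_def gen_def)
  have neg: "- scalar c \<in> carrier ?F" for c
    by (auto simp: free_algebra_def scalar_def zero_word_def)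
  have "gen i * gen j + gen j * gen i - scalar (a i j) \<in> carrier ?F"
    if "1 \<le> i" "i < j" "j \<le> n" for i j
    using a_closed[OF a_closed[OF m_closed[OF gen[of i] gen[of j]] m_closed[OF gen[of j] gen[of i]]]
        neg[of "a i j"]] that
    by (simp add: free_algebra_def)
  then show ?thesis by (auto simp: V_relations_def)
qed

lemma smult_free_algebra: "c \<odot>\<^bsub>free_algebra n\<^esub> p = scalar c * p"
  by (simp add: free_algebra_def scalar_def mult_map_scale_conv_mult)

lemma smult_quot_free_algebra:
  fixes p :: "word \<Rightarrow>\<^sub>0 'k::field"
  assumes "ideal I (free_algebra n)" "p \<in> carrier (free_algebra n)"
  shows "c \<odot>\<^bsub>quot_algebra (free_algebra n) I\<^esub> (I +>\<^bsub>free_algebra n\<^esub> p) =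
         I +>\<^bsub>free_algebra n\<^esub> (c \<odot>\<^bsub>free_algebra n\<^esub> p)"
proof -
  let ?F = "free_algebra n :: ('k, word \<Rightarrow>\<^sub>0 'k) module"
  interpret ideal I ?F by fact
  have sc: "scalar c \<in> carrier ?F"
    by (auto simp: free_algebra_def scalar_def zero_word_def)
  have mult: "c \<odot>\<^bsub>?F\<^esub> x = scalar c \<otimes>\<^bsub>?F\<^esub> x" for x
    unfolding smult_free_algebra by (simp add: free_algebra_def)
  have coset: "I +>\<^bsub>?F\<^esub> (scalar c \<otimes>\<^bsub>?F\<^esub> x) = I +>\<^bsub>?F\<^esub> (scalar c \<otimes>\<^bsub>?F\<^esub> p)"
    if x: "x \<in> I +>\<^bsub>?F\<^esub> p" for x
  proof -
    have xc: "x \<in> carrier ?F"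
      using x a_r_coset_subset_G[OF a_subset assms(2)] by blast
    have "I +>\<^bsub>?F\<^esub> x = I +>\<^bsub>?F\<^esub> p"
      using a_repr_independence[OF x assms(2) a_subgroup] by simp
    then show ?thesis
      using rcoset_mult_add[OF sc xc] rcoset_mult_add[OF sc assms(2)] by metis
  qed
  have "p \<in> I +>\<^bsub>?F\<^esub> p"
    using a_rcos_self[OF assms(2)] .
  with coset have "(\<Union>x \<in> I +>\<^bsub>?F\<^esub> p. I +>\<^bsub>?F\<^esub> (scalar c \<otimes>\<^bsub>?F\<^esub> x)) = I +>\<^bsub>?F\<^esub> (scalar c \<otimes>\<^bsub>?F\<^esub> p)"
    by blast
  then show ?thesis
    by (simp add: quot_algebra_def mult)
qed

end

theory Submission
  imports Defs "HOL-Library.Multiset_Order" "HOL-Library.Product_Lexorder"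
begin

text \<open>
  Rescaling and permuting the generators clearly turns one family of relations into the other, so
  the point is that there are no other isomorphisms.

  The algebra \<open>V\<^sub>n(\<A>)\<close> has the ordered monomials \<open>x\<^sub>1\<^sup>e\<^sup>1 \<dots> x\<^sub>n\<^sup>e\<^sup>n\<close> as a basis. The relations let
  every word be sorted, so these monomials span; they are independent because the algebra acts on a
  space with basis \<open>|e\<rangle>\<close>, \<open>e\<close> an exponent vector, in such a way that the ordered monomial with
  exponent \<open>e\<close> sends the vacuum \<open>|0\<rangle>\<close> to \<open>|e\<rangle>\<close> (lemma \<open>normal_form\<close>). Up to terms that are lower in
  the degree-lexicographic order, an ordered monomial with exponent \<open>e\<close> sends \<open>|f\<rangle>\<close> to
  \<open>(-1)\<^sup>c|e + f\<rangle>\<close>, where \<open>c\<close> is the number of inversions between \<open>e\<close> and \<open>f\<close>. Thus every nonzero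
  element has a leading exponent, leading exponents add under multiplication, and the leading
  coefficients multiply up to this sign (\<open>leading_mult\<close>).

  Let \<open>u\<^sub>1, \<dots>, u\<^sub>n\<close> be the images of the generators under an isomorphism to \<open>V\<^sub>n(\<A>')\<close> and \<open>E\<^sub>i\<close> their
  leading exponents. No \<open>u\<^sub>i\<close> is a scalar, and \<open>u\<^sub>i u\<^sub>j + u\<^sub>j u\<^sub>i\<close> is one, so the leading terms of
  \<open>u\<^sub>i u\<^sub>j\<close> and \<open>u\<^sub>j u\<^sub>i\<close> cancel; as \<open>2 \<noteq> 0\<close>, this forces the alternating form \<open>\<omega>\<close> on exponents
  modulo 2 which counts the inversions in both directions to take the value 1 on \<open>(E\<^sub>i, E\<^sub>j)\<close> for all
  \<open>i \<noteq> j\<close> (\<open>leading_anticommute\<close>). For even \<open>n\<close> the matrix with zeros on the diagonal and ones elsewhere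
  is invertible modulo 2, so the \<open>E\<^sub>i\<close> are linearly independent modulo 2 and hence over the rationals
  (\<open>sum_mset_inj_of_odd_crossings\<close>). Therefore the ordered monomials in the \<open>u\<^sub>i\<close> have pairwise
  different leading exponents \<open>\<Sum> m\<^sub>i E\<^sub>i\<close>, and no cancellation of leading terms can occur between them.
  Since they span \<open>V\<^sub>n(\<A>')\<close>, every exponent vector is a sum \<open>\<Sum> m\<^sub>i E\<^sub>i\<close>. In particular every unit
  vector is one of the \<open>E\<^sub>i\<close>, and by counting the \<open>E\<^sub>i\<close> are the unit vectors in some order
  (\<open>leading_exponents_of_generators\<close>).

  In a degree order this means that each \<open>u\<^sub>i\<close> is of degree one. The coefficient of \<open>x\<^sub>r\<^sup>2\<close> in
  \<open>u\<^sub>i u\<^sub>j + u\<^sub>j u\<^sub>i\<close> shows that no \<open>x\<^sub>r\<close> occurs in both \<open>u\<^sub>i\<close> and \<open>u\<^sub>j\<close>, so that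
  \<open>u\<^sub>i = \<lambda>\<^sub>i x\<^sub>\<tau>\<^sub>(\<^sub>i\<^sub>) + \<beta>\<^sub>i\<close>; the linear terms give \<open>\<beta>\<^sub>i = 0\<close> and the constant terms give the asserted
  relation between the scalars.
\<close>

section \<open>Linear maps between finitely supported functions\<close>

lemma single_zero_central:
  fixes p :: "'x::monoid_add \<Rightarrow>\<^sub>0 'k::comm_ring_1"
  shows "p * Poly_Mapping.single 0 c = Poly_Mapping.single 0 c * p"
proof (induction p rule: update_induct)
  case const
  then show ?case by simp
next
  case (update p w b)
  have "Poly_Mapping.update w b p = p + Poly_Mapping.single w b"
    using update by (intro poly_mapping_eqI) (auto simp: lookup_update lookup_add lookup_single in_keys_iff when_def)
  with update show ?case
    by (simp add: distrib_left distrib_right mult_single mult.commute)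
qed

definition linear_extension ::
  "('x \<Rightarrow> ('y::monoid_add \<Rightarrow>\<^sub>0 'k::field)) \<Rightarrow> ('x \<Rightarrow>\<^sub>0 'k) \<Rightarrow> ('y \<Rightarrow>\<^sub>0 'k)" where
  "linear_extension B p =
     (\<Sum>x \<in> Poly_Mapping.keys p. Poly_Mapping.single 0 (Poly_Mapping.lookup p x) * B x)"

lemma linear_extension_superset:
  assumes "finite S" "Poly_Mapping.keys p \<subseteq> S"
  shows "linear_extension B p = (\<Sum>x \<in> S. Poly_Mapping.single 0 (Poly_Mapping.lookup p x) * B x)"
  unfolding linear_extension_def using assms
  by (intro sum.mono_neutral_left) (auto simp: in_keys_iff)

lemma linear_extension_zero [simp]: "linear_extension B 0 = 0"
  by (simp add: linear_extension_def)

lemma linear_extension_add: "linear_extension B (p + q) = linear_extension B p + linear_extension B q"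
proof -
  let ?S = "Poly_Mapping.keys p \<union> Poly_Mapping.keys q"
  have "finite ?S" by simp
  from linear_extension_superset[OF this, of p B] linear_extension_superset[OF this, of q B]
    linear_extension_superset[OF this Poly_Mapping.keys_add, of B]
  show ?thesis
    by (simp add: lookup_add single_add distrib_right sum.distrib)
qed

lemma linear_extension_single [simp]:
  "linear_extension B (Poly_Mapping.single x c) = Poly_Mapping.single 0 c * B x"
  by (subst linear_extension_superset[of "{x}"]) auto

lemma single_zero_mult_single:
  fixes x :: "'x::monoid_add" and c d :: "'k::semiring_0"
  shows "Poly_Mapping.single 0 c * Poly_Mapping.single x d = Poly_Mapping.single x (c * d)"
  by (simp add: mult_single)

lemma lookup_scalar_mult:
  fixes p :: "'x::monoid_add \<Rightarrow>\<^sub>0 'k::semiring_0"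
  shows "Poly_Mapping.lookup (Poly_Mapping.single 0 c * p) x = c * Poly_Mapping.lookup p x"
  by (simp add: mult_map_scale_conv_mult [symmetric] Poly_Mapping.map.rep_eq when_def)

lemma poly_mapping_sum_singles:
  "p = (\<Sum>x \<in> Poly_Mapping.keys p. Poly_Mapping.single x (Poly_Mapping.lookup p x))"
proof (rule poly_mapping_eqI)
  fix x
  show "Poly_Mapping.lookup p x =
    Poly_Mapping.lookup (\<Sum>x \<in> Poly_Mapping.keys p. Poly_Mapping.single x (Poly_Mapping.lookup p x)) x"
    by (cases "x \<in> Poly_Mapping.keys p")
      (auto simp: lookup_sum lookup_single when_def in_keys_iff sum.delta)
qed

text \<open>
  The scalar \<open>c\<close> acts as multiplication by the constant \<open>single 0 c\<close>, which works uniformly for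
  noncommutative polynomials (indexed by words) and for the space with basis the exponent vectors
  (indexed by multisets).
\<close>

definition linear_map ::
  "(('x::monoid_add \<Rightarrow>\<^sub>0 'k::field) \<Rightarrow> ('y::monoid_add \<Rightarrow>\<^sub>0 'k)) \<Rightarrow> bool" where
  "linear_map T \<longleftrightarrow> (\<forall>p q. T (p + q) = T p + T q) \<and>
     (\<forall>c p. T (Poly_Mapping.single 0 c * p) = Poly_Mapping.single 0 c * T p)"

lemma linear_map_add: "linear_map T \<Longrightarrow> T (p + q) = T p + T q"
  and linear_map_scale: "linear_map T \<Longrightarrow> T (Poly_Mapping.single 0 c * p) = Poly_Mapping.single 0 c * T p"
  by (auto simp: linear_map_def)

lemma linear_map_zero: "linear_map T \<Longrightarrow> T 0 = 0"
  using linear_map_scale[of T 0 0] by simp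

lemma linear_map_uminus: "linear_map T \<Longrightarrow> T (- p) = - T p"
  using linear_map_add[of T p "- p"] linear_map_zero[of T]
  by (simp add: eq_neg_iff_add_eq_0 add.commute)

lemma linear_map_diff: "linear_map T \<Longrightarrow> T (p - q) = T p - T q"
  using linear_map_add[of T p "- q"] linear_map_uminus[of T q] by simp

lemma linear_map_sum:
  assumes "linear_map T" shows "T (sum f S) = (\<Sum>x \<in> S. T (f x))"
  by (induction S rule: infinite_finite_induct)
     (simp_all add: linear_map_zero linear_map_add assms)

lemma linear_map_linear_extension: "linear_map (linear_extension B)"
proof -
  have "linear_extension B (Poly_Mapping.single 0 c * p) = Poly_Mapping.single 0 c * linear_extension B p"
    for c and p
  proof -
    have "Poly_Mapping.keys (Poly_Mapping.single 0 c * p) \<subseteq> Poly_Mapping.keys p"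
      by (auto simp: in_keys_iff lookup_scalar_mult)
    from linear_extension_superset[OF _ this, of B] show ?thesis
      by (simp add: lookup_scalar_mult linear_extension_def sum_distrib_left mult.assoc [symmetric]
          single_zero_mult_single)
  qed
  then show ?thesis by (simp add: linear_map_def linear_extension_add)
qed

lemma linear_map_eq_linear_extension:
  assumes "linear_map T"
  shows "T p = linear_extension (\<lambda>x. T (Poly_Mapping.single x 1)) p"
proof -
  have "T p = T (\<Sum>x \<in> Poly_Mapping.keys p. Poly_Mapping.single 0 (Poly_Mapping.lookup p x) * Poly_Mapping.single x 1)"
    by (subst poly_mapping_sum_singles[of p]) (simp add: single_zero_mult_single)
  also have "\<dots> = linear_extension (\<lambda>x. T (Poly_Mapping.single x 1)) p"
    by (simp add: linear_map_sum assms linear_map_scale linear_extension_def)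
  finally show ?thesis .
qed

text \<open>Used throughout to reduce operator identities to their values on basis vectors.\<close>

lemma linear_map_eqI:
  assumes "linear_map T" "linear_map U"
    and "\<And>x. T (Poly_Mapping.single x 1) = U (Poly_Mapping.single x 1)"
  shows "T p = U p"
  unfolding linear_map_eq_linear_extension[OF assms(1), of p]
    linear_map_eq_linear_extension[OF assms(2), of p] assms(3) ..

lemma linear_map_ident: "linear_map (\<lambda>p. p)"
  and linear_map_const_zero: "linear_map (\<lambda>p. 0)"
  and linear_map_plus: "linear_map T \<Longrightarrow> linear_map U \<Longrightarrow> linear_map (\<lambda>p. T p + U p)"
  and linear_map_right_mult: "linear_map T \<Longrightarrow> linear_map (\<lambda>p. T p * q)"
  and linear_map_sum_maps:
    "(\<And>s. s \<in> S \<Longrightarrow> linear_map (V s)) \<Longrightarrow> linear_map (\<lambda>p. \<Sum>s\<in>S. V s p)"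
  by (simp_all add: linear_map_def distrib_left distrib_right
      sum.distrib sum_distrib_left mult.assoc)

lemma linear_map_compose: "linear_map T \<Longrightarrow> linear_map U \<Longrightarrow> linear_map (\<lambda>p. T (U p))"
  by (simp add: linear_map_def)

lemma linear_map_left_mult:
  assumes "linear_map T" shows "linear_map (\<lambda>p. r * T p)"
proof -
  have "r * (Poly_Mapping.single 0 c * T p) = Poly_Mapping.single 0 c * (r * T p)" for c p
    by (subst mult.assoc [symmetric], subst single_zero_central) (simp only: mult.assoc)
  with assms show ?thesis by (simp add: linear_map_def distrib_left)
qed

section \<open>Evaluating noncommutative polynomials\<close>

text \<open>
  The value at \<open>m\<close> of the noncommutative polynomial \<open>p\<close> in the operators \<open>A i\<close>. The empty word acts
  as the identity, and the first letter of a word is the last operator to be applied.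
\<close>

definition represent ::
  "(nat \<Rightarrow> ('y::monoid_add \<Rightarrow>\<^sub>0 'k) \<Rightarrow> ('y \<Rightarrow>\<^sub>0 'k)) \<Rightarrow> (word \<Rightarrow>\<^sub>0 'k::field) \<Rightarrow> ('y \<Rightarrow>\<^sub>0 'k) \<Rightarrow> ('y \<Rightarrow>\<^sub>0 'k)" where
  "represent A p m = linear_extension (\<lambda>w. foldr A (letters w) m) p"

lemma linear_map_represent_left: "linear_map (\<lambda>p. represent A p m)"
  unfolding represent_def by (rule linear_map_linear_extension)

lemmas represent_add = linear_map_add [OF linear_map_represent_left]
  and represent_diff = linear_map_diff [OF linear_map_represent_left]
  and represent_uminus = linear_map_uminus [OF linear_map_represent_left]
  and represent_sum = linear_map_sum [OF linear_map_represent_left]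
  and represent_zero = linear_map_zero [OF linear_map_represent_left]

lemma represent_single [simp]:
  "represent A (Poly_Mapping.single w c) m = Poly_Mapping.single 0 c * foldr A (letters w) m"
  by (simp add: represent_def)

lemma letters_zero [simp]: "letters 0 = []"
  by (simp add: zero_word_def)

lemma represent_one [simp]: "represent A 1 m = m"
  using represent_single[of A 0 1 m] by simp

lemma represent_gen [simp]: "represent A (gen i) m = A i m"
  by (simp add: gen_def)

lemma represent_scalar [simp]: "represent A (scalar c) m = Poly_Mapping.single 0 c * m"
  by (simp add: scalar_def)

lemma linear_map_foldr:
  assumes "\<And>i. linear_map (A i)"
  shows "linear_map (foldr A is)"
  by (induction "is") (simp_all add: linear_map_def assms[unfolded linear_map_def])

lemma linear_map_represent:
  assumes "\<And>i. linear_map (A i)"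
  shows "linear_map (represent A p)"
  unfolding represent_def linear_extension_def
  by (intro linear_map_sum_maps linear_map_left_mult linear_map_foldr assms)

lemma represent_mult:
  assumes "\<And>i. linear_map (A i)"
  shows "represent A (p * q) m = represent A p (represent A q m)"
proof (rule linear_map_eqI[of "\<lambda>p. represent A (p * q) m" "\<lambda>p. represent A p (represent A q m)"])
  show "linear_map (\<lambda>p. represent A (p * q) m)"
    using linear_map_compose[OF linear_map_represent_left[of A m] linear_map_right_mult[OF linear_map_ident, of q]] .
  show "linear_map (\<lambda>p. represent A p (represent A q m))"
    by (rule linear_map_represent_left)
  fix w
  show "represent A (Poly_Mapping.single w 1 * q) m = represent A (Poly_Mapping.single w 1) (represent A q m)"
  proof (rule linear_map_eqI[of "\<lambda>q. represent A (Poly_Mapping.single w 1 * q) m"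
        "\<lambda>q. represent A (Poly_Mapping.single w 1) (represent A q m)"])
    show "linear_map (\<lambda>q. represent A (Poly_Mapping.single w 1 * q) m)"
      using linear_map_compose[OF linear_map_represent_left[of A m] linear_map_left_mult[OF linear_map_ident]] .
    show "linear_map (\<lambda>q. represent A (Poly_Mapping.single w 1) (represent A q m))"
      using linear_map_compose[OF linear_map_represent[OF assms] linear_map_represent_left] .
  qed (simp add: mult_single plus_word_def)
qed

lemma represent_commute:
  assumes "linear_map T" "\<And>i m. i \<in> S \<Longrightarrow> T (A i m) = B i (T m)"
    and "\<forall>w \<in> Poly_Mapping.keys p. set (letters w) \<subseteq> S"
  shows "T (represent A p m) = represent B p (T m)"
proof -
  have "T (foldr A is m) = foldr B is (T m)" if "set is \<subseteq> S" for "is"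
    using that by (induction "is") (simp_all add: assms(2))
  with assms(3) show ?thesis
    by (simp add: represent_def linear_extension_def linear_map_sum[OF assms(1)] linear_map_scale[OF assms(1)])
qed

text \<open>
  The endomorphism \<open>x\<^sub>i \<mapsto> u\<^sub>i\<close> of the free algebra is evaluation at the operators of left
  multiplication by \<open>u\<^sub>i\<close>, applied to \<open>1\<close>; this makes multiplicativity an instance of
  \<open>represent_mult\<close>.
\<close>

definition substitute :: "(nat \<Rightarrow> (word \<Rightarrow>\<^sub>0 'k)) \<Rightarrow> (word \<Rightarrow>\<^sub>0 'k::field) \<Rightarrow> (word \<Rightarrow>\<^sub>0 'k)" where
  "substitute u p = represent (\<lambda>i. (*) (u i)) p 1"

lemma linear_map_times: "linear_map ((*) r)"
  using linear_map_left_mult[OF linear_map_ident] .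

lemma linear_map_substitute: "linear_map (substitute u)"
  using linear_map_represent_left[of "\<lambda>i. (*) (u i)" 1] by (simp add: substitute_def[abs_def])

lemma represent_times: "represent (\<lambda>i. (*) (u i)) p m = substitute u p * m"
  using represent_commute[of "\<lambda>x. x * m" UNIV "\<lambda>i. (*) (u i)" "\<lambda>i. (*) (u i)" p 1,
      OF linear_map_right_mult[OF linear_map_ident]]
  by (simp add: substitute_def mult.assoc)

lemma substitute_mult: "substitute u (p * q) = substitute u p * substitute u q"
  using represent_mult[of "\<lambda>i. (*) (u i)" p q 1]
  by (simp add: linear_map_times represent_times[symmetric])
     (simp add: substitute_def)

lemmas substitute_add = linear_map_add [OF linear_map_substitute]
  and substitute_diff = linear_map_diff [OF linear_map_substitute]
  and substitute_uminus = linear_map_uminus [OF linear_map_substitute]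
  and substitute_sum = linear_map_sum [OF linear_map_substitute]
  and substitute_zero = linear_map_zero [OF linear_map_substitute]
  and substitute_scale = linear_map_scale [OF linear_map_substitute]

lemma substitute_one [simp]: "substitute u 1 = 1"
  by (simp add: substitute_def)

lemma substitute_gen [simp]: "substitute u (gen i) = u i"
  by (simp add: substitute_def)

lemma substitute_scalar [simp]: "substitute u (scalar c) = scalar c"
  by (simp add: substitute_def scalar_def)

section \<open>The free algebra and the ideal of relations\<close>

abbreviation (input) free_carrier :: "nat \<Rightarrow> (word \<Rightarrow>\<^sub>0 'k::field) set" where
  "free_carrier n \<equiv> carrier (free_algebra n)"

lemma free_algebra_simps [simp]:
  "(\<otimes>\<^bsub>free_algebra n\<^esub>) = (*)" "(\<oplus>\<^bsub>free_algebra n\<^esub>) = (+)"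
  "\<one>\<^bsub>free_algebra n\<^esub> = 1" "\<zero>\<^bsub>free_algebra n\<^esub> = 0"
  by (simp_all add: free_algebra_def)

lemma free_carrier_zero [simp]: "0 \<in> free_carrier n"
  and free_carrier_one [simp]: "1 \<in> free_carrier n"
  and free_carrier_add: "p \<in> free_carrier n \<Longrightarrow> q \<in> free_carrier n \<Longrightarrow> p + q \<in> free_carrier n"
  and free_carrier_mult: "p \<in> free_carrier n \<Longrightarrow> q \<in> free_carrier n \<Longrightarrow> p * q \<in> free_carrier n"
  using ring.ring_simprules[OF ring_free_algebra[of n]] by simp_all

lemma free_carrier_uminus: "p \<in> free_carrier n \<Longrightarrow> - p \<in> free_carrier n"
  by (simp add: free_algebra_def)

lemma free_carrier_diff: "p \<in> free_carrier n \<Longrightarrow> q \<in> free_carrier n \<Longrightarrow> p - q \<in> free_carrier n"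
  using free_carrier_add[of p n "- q"] free_carrier_uminus[of q n] by simp

lemma free_carrier_sum:
  "(\<And>x. x \<in> S \<Longrightarrow> f x \<in> free_carrier n) \<Longrightarrow> sum f S \<in> free_carrier n"
  by (induction S rule: infinite_finite_induct) (simp_all add: free_carrier_add)

lemma free_carrier_single:
  "set is \<subseteq> {1..n} \<Longrightarrow> Poly_Mapping.single (Word is) c \<in> free_carrier n"
  by (simp add: free_algebra_def)

lemma free_carrier_gen: "i \<in> {1..n} \<Longrightarrow> gen i \<in> free_carrier n"
  unfolding gen_def by (rule free_carrier_single) simp

lemma free_carrier_scalar [simp]: "scalar c \<in> free_carrier n"
  unfolding scalar_def zero_word_def by (rule free_carrier_single) simp

lemma free_carrier_keys:
  "p \<in> free_carrier n \<longleftrightarrow> (\<forall>w \<in> Poly_Mapping.keys p. set (letters w) \<subseteq> {1..n})"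
  by (simp add: free_algebra_def)

lemmas free_carrier_intros = free_carrier_add free_carrier_mult free_carrier_uminus
  free_carrier_diff free_carrier_sum free_carrier_gen

lemma single_Word_Cons: "Poly_Mapping.single (Word (i # is)) (1::'k::field) = gen i * Poly_Mapping.single (Word is) 1"
  by (simp add: gen_def mult_single plus_word_def)

lemma single_Word_Nil [simp]: "Poly_Mapping.single (Word []) (1::'k::field) = 1"
  by (simp flip: zero_word_def)

text \<open>
  Every polynomial is a linear combination of words, and a word is built letter by letter from the
  left.
\<close>

lemma free_carrier_induct [consumes 1, case_names zero add scale one gen]:
  fixes p :: "word \<Rightarrow>\<^sub>0 'k::field"
  assumes p: "p \<in> free_carrier n"
    and "P 0" and add: "\<And>p q. P p \<Longrightarrow> P q \<Longrightarrow> P (p + q)"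
    and scale: "\<And>c p. p \<in> free_carrier n \<Longrightarrow> P p \<Longrightarrow> P (scalar c * p)"
    and one: "P 1"
    and gen: "\<And>i p. i \<in> {1..n} \<Longrightarrow> p \<in> free_carrier n \<Longrightarrow> P p \<Longrightarrow> P (gen i * p)"
  shows "P p"
proof -
  have word: "P (Poly_Mapping.single (Word is) 1)" if "set is \<subseteq> {1..n}" for "is"
    using that
  proof (induction "is")
    case (Cons i "is")
    then show ?case unfolding single_Word_Cons by (intro gen free_carrier_single) auto
  qed (simp add: one)
  have "P (\<Sum>w \<in> W. Poly_Mapping.single w (Poly_Mapping.lookup p w))"
    if "finite W" "W \<subseteq> Poly_Mapping.keys p" for W
    using that
  proof (induction W rule: finite_induct)
    case (insert w W)
    obtain "is" where w: "w = Word is" by (cases w)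
    have "set is \<subseteq> {1..n}"
      using p insert.prems w by (fastforce simp: free_carrier_keys)
    then have "P (scalar (Poly_Mapping.lookup p w) * Poly_Mapping.single (Word is) 1)"
      by (intro scale word free_carrier_single)
    then show ?case using insert w
      by (simp add: add scalar_def single_zero_mult_single)
  qed (simp add: assms(2))
  from this[of "Poly_Mapping.keys p"] show ?thesis
    by (simp flip: poly_mapping_sum_singles)
qed

lemma free_carrier_substitute:
  assumes "p \<in> free_carrier n" "\<And>i. i \<in> {1..n} \<Longrightarrow> u i \<in> free_carrier m"
  shows "substitute u p \<in> free_carrier m"
  using assms(1)
  by (induction rule: free_carrier_induct)
     (simp_all add: substitute_add substitute_mult substitute_zero free_carrier_add free_carrier_mult assms(2))

definition relation_ideal :: "nat \<Rightarrow> (nat \<Rightarrow> nat \<Rightarrow> 'k::field) \<Rightarrow> (word \<Rightarrow>\<^sub>0 'k) set" where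
  "relation_ideal n a = genideal (free_algebra n) (V_relations n a)"

lemma ideal_relation_ideal: "ideal (relation_ideal n a) (free_algebra n)"
  unfolding relation_ideal_def
  by (rule ring.genideal_ideal[OF ring_free_algebra V_relations_subset])

lemma relation_ideal_carrier: "p \<in> relation_ideal n a \<Longrightarrow> p \<in> free_carrier n"
  using additive_subgroup.a_subset[OF ideal.axioms(1)[OF ideal_relation_ideal]] by blast

lemma relation_ideal_zero [simp]: "0 \<in> relation_ideal n a"
  and relation_ideal_add: "p \<in> relation_ideal n a \<Longrightarrow> q \<in> relation_ideal n a \<Longrightarrow> p + q \<in> relation_ideal n a"
  using additive_subgroup.zero_closed[OF ideal.axioms(1)[OF ideal_relation_ideal[of n a]]]
    additive_subgroup.a_closed[OF ideal.axioms(1)[OF ideal_relation_ideal[of n a]]] by simp_all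

lemma relation_ideal_mult_left:
  "p \<in> relation_ideal n a \<Longrightarrow> q \<in> free_carrier n \<Longrightarrow> q * p \<in> relation_ideal n a"
  and relation_ideal_mult_right:
  "p \<in> relation_ideal n a \<Longrightarrow> q \<in> free_carrier n \<Longrightarrow> p * q \<in> relation_ideal n a"
  using ideal.I_l_closed[OF ideal_relation_ideal[of n a]] ideal.I_r_closed[OF ideal_relation_ideal[of n a]]
  by simp_all

lemma relation_ideal_uminus: "p \<in> relation_ideal n a \<Longrightarrow> - p \<in> relation_ideal n a"
  using relation_ideal_mult_left[of p n a "- 1"] by (simp add: free_carrier_uminus)

lemma relation_ideal_diff:
  "p \<in> relation_ideal n a \<Longrightarrow> q \<in> relation_ideal n a \<Longrightarrow> p - q \<in> relation_ideal n a"
  using relation_ideal_add[of p n a "- q"] relation_ideal_uminus[of q n a] by simp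

lemma relation_ideal_relation:
  "1 \<le> i \<Longrightarrow> i < j \<Longrightarrow> j \<le> n \<Longrightarrow>
   gen i * gen j + gen j * gen i - scalar (a i j) \<in> relation_ideal n a"
  using ring.genideal_self[OF ring_free_algebra V_relations_subset, of n a]
  unfolding relation_ideal_def V_relations_def by blast

lemma relation_ideal_induct [consumes 1, case_names zero add uminus left right relation]:
  fixes p :: "word \<Rightarrow>\<^sub>0 'k::field"
  assumes p: "p \<in> relation_ideal n a"
    and zero: "P 0"
    and add: "\<And>p q. p \<in> free_carrier n \<Longrightarrow> q \<in> free_carrier n \<Longrightarrow> P p \<Longrightarrow> P q \<Longrightarrow> P (p + q)"
    and uminus: "\<And>p. p \<in> free_carrier n \<Longrightarrow> P p \<Longrightarrow> P (- p)"
    and left: "\<And>p q. p \<in> free_carrier n \<Longrightarrow> P p \<Longrightarrow> q \<in> free_carrier n \<Longrightarrow> P (q * p)"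
    and right: "\<And>p q. p \<in> free_carrier n \<Longrightarrow> P p \<Longrightarrow> q \<in> free_carrier n \<Longrightarrow> P (p * q)"
    and relation: "\<And>i j. 1 \<le> i \<Longrightarrow> i < j \<Longrightarrow> j \<le> n \<Longrightarrow> P (gen i * gen j + gen j * gen i - scalar (a i j))"
  shows "P p"
proof -
  let ?F = "free_algebra n :: ('k, word \<Rightarrow>\<^sub>0 'k) module"
  let ?J = "{p \<in> carrier ?F. P p}"
  interpret ring ?F by (rule ring_free_algebra)
  have a_inv: "\<ominus>\<^bsub>?F\<^esub> q = - q" if "q \<in> carrier ?F" for q
    using that by (intro minus_equality) (simp_all add: free_carrier_uminus)
  have "ideal ?J ?F"
  proof (rule idealI)
    show "subgroup ?J (add_monoid ?F)"
      by (rule add.subgroupI) (auto simp: zero uminus add free_carrier_uminus free_carrier_add a_inv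
          simp flip: a_inv_def)
  qed (auto simp: ring_axioms left right free_carrier_mult)
  moreover have "V_relations n a \<subseteq> ?J"
    using V_relations_subset[of n a] relation by (auto simp: V_relations_def)
  ultimately have "relation_ideal n a \<subseteq> ?J"
    unfolding relation_ideal_def by (rule genideal_minimal)
  with p show ?thesis by blast
qed

text \<open>
  The polynomials that annihilate every vector form a two-sided ideal, so it is enough that the
  relations do.
\<close>

lemma represent_relation_ideal:
  assumes "p \<in> relation_ideal n a" and lin: "\<And>i. linear_map (A i)"
    and rel: "\<And>i j m. 1 \<le> i \<Longrightarrow> i < j \<Longrightarrow> j \<le> n \<Longrightarrow>
      A i (A j m) + A j (A i m) = Poly_Mapping.single 0 (a i j) * m"
  shows "represent A p m = 0"
  using assms(1)
proof (induction arbitrary: m rule: relation_ideal_induct)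
  case (left p q)
  then show ?case by (simp add: represent_mult lin linear_map_zero[OF linear_map_represent, OF lin])
qed (simp_all add: represent_mult lin represent_zero represent_add represent_uminus represent_diff rel)

lemma substitute_relation_ideal:
  assumes "p \<in> relation_ideal n a"
    and u: "\<And>i. i \<in> {1..n} \<Longrightarrow> u i \<in> free_carrier m"
    and rel: "\<And>i j. 1 \<le> i \<Longrightarrow> i < j \<Longrightarrow> j \<le> n \<Longrightarrow>
      u i * u j + u j * u i - scalar (a i j) \<in> relation_ideal m b"
  shows "substitute u p \<in> relation_ideal m b"
proof -
  have "substitute u q \<in> free_carrier m" if "q \<in> free_carrier n" for q
    using that u by (rule free_carrier_substitute)
  with assms(1) show ?thesis
    by (induction rule: relation_ideal_induct)
       (simp_all add: substitute_mult substitute_zero substitute_add substitute_uminus substitute_diff rel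
         relation_ideal_add relation_ideal_uminus relation_ideal_mult_left relation_ideal_mult_right)
qed

section \<open>Isomorphisms as substitutions\<close>

definition coset :: "nat \<Rightarrow> (nat \<Rightarrow> nat \<Rightarrow> 'k::field) \<Rightarrow> (word \<Rightarrow>\<^sub>0 'k) \<Rightarrow> (word \<Rightarrow>\<^sub>0 'k) set" where
  "coset n a p = relation_ideal n a +>\<^bsub>free_algebra n\<^esub> p"

lemma mem_coset: "q \<in> coset n a p \<longleftrightarrow> q - p \<in> relation_ideal n a"
proof -
  have "q \<in> coset n a p \<longleftrightarrow> (\<exists>r \<in> relation_ideal n a. q = r + p)"
    by (simp add: coset_def a_r_coset_def')
  also have "\<dots> \<longleftrightarrow> q - p \<in> relation_ideal n a"
    by (metis add_diff_cancel diff_add_cancel)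
  finally show ?thesis .
qed

lemma coset_eq_iff: "coset n a p = coset n a q \<longleftrightarrow> p - q \<in> relation_ideal n a"
proof
  assume "coset n a p = coset n a q"
  then show "p - q \<in> relation_ideal n a"
    using mem_coset[of p n a p] mem_coset[of p n a q] by simp
next
  assume pq: "p - q \<in> relation_ideal n a"
  have "r - p \<in> relation_ideal n a \<longleftrightarrow> r - q \<in> relation_ideal n a" for r
    using relation_ideal_add[of "r - p" n a, OF _ pq] relation_ideal_diff[of "r - q" n a, OF _ pq] by auto
  then show "coset n a p = coset n a q" by (auto simp: mem_coset)
qed

lemma V_algebra_eq: "V_algebra n a = quot_algebra (free_algebra n) (relation_ideal n a)"
  by (simp add: V_algebra_def relation_ideal_def)

lemma carrier_V_algebra: "carrier (V_algebra n a) = coset n a ` carrier (free_algebra n)"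
  by (auto simp: V_algebra_eq quot_algebra_def FactRing_def A_RCOSETS_def' coset_def)

lemma coset_closed: "p \<in> carrier (free_algebra n) \<Longrightarrow> coset n a p \<in> carrier (V_algebra n a)"
  by (auto simp: carrier_V_algebra)

lemma V_algebra_mult:
  "p \<in> carrier (free_algebra n) \<Longrightarrow> q \<in> carrier (free_algebra n) \<Longrightarrow>
   coset n a p \<otimes>\<^bsub>V_algebra n a\<^esub> coset n a q = coset n a (p * q)"
  using ideal.rcoset_mult_add[OF ideal_relation_ideal[of n a], of p q]
  by (simp add: V_algebra_eq quot_algebra_def FactRing_def coset_def)

lemma V_algebra_add:
  assumes "p \<in> carrier (free_algebra n)" "q \<in> carrier (free_algebra n)"
  shows "coset n a p \<oplus>\<^bsub>V_algebra n a\<^esub> coset n a q = coset n a (p + q)"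
proof -
  interpret ideal "relation_ideal n a" "free_algebra n"
    by (rule ideal_relation_ideal)
  show ?thesis
    using a_rcos_sum[OF assms] by (simp add: V_algebra_eq quot_algebra_def FactRing_def coset_def)
qed

lemma V_algebra_one: "\<one>\<^bsub>V_algebra n a\<^esub> = coset n a 1"
  by (simp add: V_algebra_eq quot_algebra_def FactRing_def coset_def)

lemma V_algebra_smult:
  "p \<in> carrier (free_algebra n) \<Longrightarrow> c \<odot>\<^bsub>V_algebra n a\<^esub> coset n a p = coset n a (scalar c * p)"
  using smult_quot_free_algebra[OF ideal_relation_ideal[of n a], of p c]
  by (simp add: V_algebra_eq coset_def smult_free_algebra)

text \<open>
  Lift the images of the generators to polynomials \<open>u i\<close>. Two algebra homomorphisms that agree on
  generators agree, hence the given isomorphism is induced by \<open>x\<^sub>i \<mapsto> u\<^sub>i\<close>.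
\<close>

lemma algebra_iso_substitution:
  fixes a b :: "nat \<Rightarrow> nat \<Rightarrow> 'k::field"
  assumes h: "h \<in> algebra_iso (V_algebra n a) (V_algebra n b)"
  obtains u where "\<And>i. i \<in> {1..n} \<Longrightarrow> u i \<in> free_carrier n"
    and "\<And>p. p \<in> free_carrier n \<Longrightarrow> h (coset n a p) = coset n b (substitute u p)"
proof -
  let ?A = "V_algebra n a" and ?B = "V_algebra n b"
  have hom: "h \<in> ring_hom ?A ?B"
    and scale: "\<And>c x. x \<in> carrier ?A \<Longrightarrow> h (c \<odot>\<^bsub>?A\<^esub> x) = c \<odot>\<^bsub>?B\<^esub> h x"
    using h by (auto simp: algebra_iso_def ring_iso_def)
  have "\<exists>q \<in> free_carrier n. h (coset n a (gen i)) = coset n b q" if "i \<in> {1..n}" for i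
  proof -
    have "coset n a (gen i) \<in> carrier ?A"
      by (rule coset_closed[OF free_carrier_gen[OF that]])
    from ring_hom_closed[OF hom this] show ?thesis by (auto simp: carrier_V_algebra)
  qed
  then obtain u where u: "\<And>i. i \<in> {1..n} \<Longrightarrow> u i \<in> free_carrier n"
    "\<And>i. i \<in> {1..n} \<Longrightarrow> h (coset n a (gen i)) = coset n b (u i)"
    by metis
  let ?P = "\<lambda>p. p \<in> free_carrier n \<and> h (coset n a p) = coset n b (substitute u p)"
  note closed = coset_closed[of _ n a]
  have subst: "substitute u p \<in> free_carrier n" if "p \<in> free_carrier n" for p
    using that u(1) by (rule free_carrier_substitute)
  have one: "?P 1"
    using ring_hom_one[OF hom] by (simp add: V_algebra_one)
  have scale': "?P (scalar c * p)" if "?P p" for c p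
    using that scale[OF closed, of p c] subst[of p]
    by (simp add: V_algebra_smult substitute_mult free_carrier_mult)
  have "?P p" if "p \<in> free_carrier n" for p
    using that
  proof (induction rule: free_carrier_induct)
    case zero
    then show ?case using scale'[OF one, of 0] by (simp add: scalar_def)
  next
    case (add p q)
    then show ?case
      using ring_hom_add[OF hom closed closed, of p q] subst[of p] subst[of q]
      by (simp add: V_algebra_add substitute_add free_carrier_add)
  next
    case (gen i p)
    note g = free_carrier_gen[OF gen.hyps(1), where 'a = 'k]
    from gen.IH ring_hom_mult[OF hom closed closed, of "gen i" p] subst[of p] u[OF gen.hyps(1)] g
    show ?case by (simp add: V_algebra_mult substitute_mult free_carrier_mult)
  next
    case (scale c p)
    then show ?case by (intro scale')
  qed (rule one)
  with u(1) show thesis by (intro that) auto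
qed

text \<open>
  This removes the quotients from the problem: the three conditions on the substitution say that it
  is defined, that it induces a well-defined injective map of the quotients, and that the induced map
  is surjective.
\<close>

lemma algebra_isomorphic_iff_substitution:
  "algebra_isomorphic (V_algebra n a) (V_algebra n b) \<longleftrightarrow>
   (\<exists>u. (\<forall>i\<in>{1..n}. u i \<in> free_carrier n) \<and>
     (\<forall>p\<in>free_carrier n. substitute u p \<in> relation_ideal n b \<longleftrightarrow> p \<in> relation_ideal n a) \<and>
     (\<forall>q\<in>free_carrier n. \<exists>p\<in>free_carrier n. q - substitute u p \<in> relation_ideal n b))"
  (is "?iso \<longleftrightarrow> ?subst")
proof
  let ?A = "V_algebra n a" and ?B = "V_algebra n b"
  assume ?iso
  then obtain h where h: "h \<in> algebra_iso ?A ?B" by (auto simp: algebra_isomorphic_def)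
  then have inj: "inj_on h (carrier ?A)" and surj: "h ` carrier ?A = carrier ?B"
    by (auto simp: algebra_iso_def ring_iso_def bij_betw_def)
  obtain u where u: "\<And>i. i \<in> {1..n} \<Longrightarrow> u i \<in> free_carrier n"
    and hu: "\<And>p. p \<in> free_carrier n \<Longrightarrow> h (coset n a p) = coset n b (substitute u p)"
    using algebra_iso_substitution[OF h] by metis
  have "substitute u p \<in> relation_ideal n b \<longleftrightarrow> p \<in> relation_ideal n a" if p: "p \<in> free_carrier n" for p
  proof -
    have "coset n b (substitute u p) = coset n b (substitute u 0) \<longleftrightarrow> coset n a p = coset n a 0"
      using inj_on_eq_iff[OF inj coset_closed coset_closed, of p 0] p
      by (simp add: hu[symmetric])
    then show ?thesis by (simp add: coset_eq_iff substitute_zero)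
  qed
  moreover have "\<exists>p\<in>free_carrier n. q - substitute u p \<in> relation_ideal n b" if q: "q \<in> free_carrier n" for q
  proof -
    have "coset n b q \<in> h ` carrier ?A"
      unfolding surj using q by (rule coset_closed)
    then show ?thesis using hu by (auto simp: carrier_V_algebra coset_eq_iff)
  qed
  ultimately show ?subst using u by blast
next
  let ?A = "V_algebra n a" and ?B = "V_algebra n b"
  assume ?subst
  then obtain u where u: "\<And>i. i \<in> {1..n} \<Longrightarrow> u i \<in> free_carrier n"
    and ker: "\<And>p. p \<in> free_carrier n \<Longrightarrow> substitute u p \<in> relation_ideal n b \<longleftrightarrow> p \<in> relation_ideal n a"
    and surj: "\<And>q. q \<in> free_carrier n \<Longrightarrow> \<exists>p\<in>free_carrier n. q - substitute u p \<in> relation_ideal n b"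
    by blast
  have subst: "substitute u p \<in> free_carrier n" if "p \<in> free_carrier n" for p
    using that u by (rule free_carrier_substitute)
  have eq: "coset n b (substitute u p) = coset n b (substitute u q) \<longleftrightarrow> coset n a p = coset n a q"
    if "p \<in> free_carrier n" "q \<in> free_carrier n" for p q
    using ker[OF free_carrier_diff[OF that]] by (simp add: coset_eq_iff substitute_diff)
  define h where "h X = coset n b (substitute u (SOME p. p \<in> free_carrier n \<and> X = coset n a p))" for X
  have h: "h (coset n a p) = coset n b (substitute u p)" if p: "p \<in> free_carrier n" for p
  proof -
    let ?q = "SOME q. q \<in> free_carrier n \<and> coset n a p = coset n a q"
    have "?q \<in> free_carrier n \<and> coset n a p = coset n a ?q"
      by (rule someI[of _ p]) (simp add: p)
    then show ?thesis using eq[of ?q p] p by (simp add: h_def)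
  qed
  have "h \<in> ring_hom ?A ?B"
    by (rule ring_hom_memI)
       (auto simp: carrier_V_algebra h V_algebra_mult V_algebra_add V_algebra_one subst
         substitute_mult substitute_add free_carrier_mult free_carrier_add)
  moreover have "inj_on h (carrier ?A)"
    by (auto simp: inj_on_def carrier_V_algebra h eq)
  moreover have "h ` carrier ?A = carrier ?B"
  proof
    show "h ` carrier ?A \<subseteq> carrier ?B" by (auto simp: carrier_V_algebra h subst)
    show "carrier ?B \<subseteq> h ` carrier ?A"
    proof
      fix Y assume "Y \<in> carrier ?B"
      then obtain q where q: "q \<in> free_carrier n" "Y = coset n b q" by (auto simp: carrier_V_algebra)
      then obtain p where "p \<in> free_carrier n" "q - substitute u p \<in> relation_ideal n b"
        using surj by blast
      then have "coset n a p \<in> carrier ?A" "Y = h (coset n a p)"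
        using q by (simp_all add: coset_closed h coset_eq_iff)
      then show "Y \<in> h ` carrier ?A" by blast
    qed
  qed
  moreover have "\<forall>c. \<forall>x \<in> carrier ?A. h (c \<odot>\<^bsub>?A\<^esub> x) = c \<odot>\<^bsub>?B\<^esub> h x"
    by (auto simp: carrier_V_algebra V_algebra_smult h subst substitute_mult free_carrier_mult)
  ultimately have "h \<in> algebra_iso ?A ?B"
    by (simp add: algebra_iso_def ring_iso_def bij_betw_def)
  then show ?iso by (auto simp: algebra_isomorphic_def)
qed

section \<open>Rescaled and permuted generators\<close>

lemma scalar_mult: "scalar c * scalar d = scalar (c * d)"
  by (simp add: scalar_def mult_single)

lemma scalar_central: "p * scalar c = scalar c * p"
  unfolding scalar_def by (rule single_zero_central)

lemma scalar_mult_scalar_mult: "(scalar c * p) * (scalar d * q) = scalar (c * d) * (p * q)"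
proof -
  have "(scalar c * p) * (scalar d * q) = scalar c * (p * scalar d) * q"
    by (simp only: mult.assoc)
  also have "\<dots> = scalar c * (scalar d * p) * q"
    by (simp only: scalar_central[of p])
  also have "\<dots> = scalar (c * d) * (p * q)"
    by (simp only: mult.assoc scalar_mult [symmetric])
  finally show ?thesis .
qed

lemma scalar_one [simp]: "scalar 1 = 1"
  by (simp add: scalar_def)

text \<open>The symmetric convention for the scalars makes the relations available in either order.\<close>

lemma relation_ideal_relation':
  assumes b: "\<And>i j. 1 \<le> j \<Longrightarrow> j < i \<Longrightarrow> i \<le> n \<Longrightarrow> b i j = b j i"
    and "i \<in> {1..n}" "j \<in> {1..n}" "i \<noteq> j"
  shows "gen i * gen j + gen j * gen i - scalar (b i j) \<in> relation_ideal n b"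
proof (cases "i < j")
  case True
  then show ?thesis using assms by (intro relation_ideal_relation) auto
next
  case False
  then have "b i j = b j i" using assms(2-4) by (intro b) auto
  with False show ?thesis
    using assms(2-4) relation_ideal_relation[of j i n b] by (simp add: add.commute)
qed

lemma monomial_substitution_relation_ideal:
  assumes b: "\<And>i j. 1 \<le> j \<Longrightarrow> j < i \<Longrightarrow> i \<le> n \<Longrightarrow> b i j = b j i"
    and t: "t permutes {1..n}"
    and a: "\<And>i j. i \<in> {1..n} \<Longrightarrow> j \<in> {1..n} \<Longrightarrow> i \<noteq> j \<Longrightarrow> a i j = l i * l j * b (t i) (t j)"
    and p: "p \<in> relation_ideal n a"
  shows "substitute (\<lambda>i. scalar (l i) * gen (t i)) p \<in> relation_ideal n b"
  using p
proof (rule substitute_relation_ideal)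
  fix i assume "i \<in> {1..n}"
  then show "scalar (l i) * gen (t i) \<in> free_carrier n"
    using permutes_in_image[OF t] by (intro free_carrier_mult free_carrier_gen) auto
next
  fix i j assume ij: "1 \<le> i" "i < j" "j \<le> n"
  then have "t i \<in> {1..n}" "t j \<in> {1..n}" "t i \<noteq> t j"
    using permutes_in_image[OF t] permutes_inj[OF t] by (auto dest: injD)
  then have "scalar (l i * l j) * (gen (t i) * gen (t j) + gen (t j) * gen (t i) - scalar (b (t i) (t j)))
      \<in> relation_ideal n b"
    by (intro relation_ideal_mult_left relation_ideal_relation' b) auto
  moreover have "scalar (l i) * gen (t i) * (scalar (l j) * gen (t j)) = scalar (l i * l j) * (gen (t i) * gen (t j))" for i j
    by (rule scalar_mult_scalar_mult)
  ultimately show "scalar (l i) * gen (t i) * (scalar (l j) * gen (t j)) +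
      scalar (l j) * gen (t j) * (scalar (l i) * gen (t i)) - scalar (a i j) \<in> relation_ideal n b"
    using a[of i j] ij by (simp add: right_diff_distrib distrib_left scalar_mult mult.commute[of "l j"])
qed

lemma substitute_eq_self:
  assumes "p \<in> free_carrier n" "\<And>i. i \<in> {1..n} \<Longrightarrow> w i = gen i"
  shows "substitute w p = p"
  using assms(1)
  by (induction rule: free_carrier_induct)
     (simp_all add: substitute_zero substitute_add substitute_mult assms(2))

lemma substitute_substitute:
  assumes "p \<in> free_carrier n"
  shows "substitute u (substitute v p) = substitute (\<lambda>i. substitute u (v i)) p"
  using assms
  by (induction rule: free_carrier_induct) (simp_all add: substitute_zero substitute_add substitute_mult)

text \<open>
  The substitution \<open>y\<^sub>i \<mapsto> \<lambda>\<^sub>i x\<^sub>\<sigma>\<^sub>(\<^sub>i\<^sub>)\<close> respects the relations, and so does its inverse, which is of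
  the same form.
\<close>

lemma algebra_isomorphic_if_rescaled:
  fixes a b :: "nat \<Rightarrow> nat \<Rightarrow> 'k::field"
  assumes a: "\<And>i j. 1 \<le> j \<Longrightarrow> j < i \<Longrightarrow> i \<le> n \<Longrightarrow> a i j = a j i"
    and b: "\<And>i j. 1 \<le> j \<Longrightarrow> j < i \<Longrightarrow> i \<le> n \<Longrightarrow> b i j = b j i"
    and s: "s permutes {1..n}" and l: "\<And>i. i \<in> {1..n} \<Longrightarrow> l i \<noteq> 0"
    and ba: "\<And>i j. i \<in> {1..n} \<Longrightarrow> j \<in> {1..n} \<Longrightarrow> i \<noteq> j \<Longrightarrow> b i j = l i * l j * a (s i) (s j)"
  shows "algebra_isomorphic (V_algebra n a) (V_algebra n b)"
proof -
  let ?t = "inv_into UNIV s" and ?l' = "\<lambda>i. inverse (l (inv_into UNIV s i))"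
  let ?u = "\<lambda>i. scalar (?l' i) * gen (?t i) :: word \<Rightarrow>\<^sub>0 'k"
  let ?v = "\<lambda>i. scalar (l i) * gen (s i) :: word \<Rightarrow>\<^sub>0 'k"
  have t: "?t permutes {1..n}" by (rule permutes_inv[OF s])
  have st: "s (?t i) = i" "?t (s i) = i" for i
    by (rule permutes_inverses[OF s])+
  have s_in: "s i \<in> {1..n}" and t_in: "?t i \<in> {1..n}" if "i \<in> {1..n}" for i
    using that permutes_in_image[OF s] permutes_in_image[OF t] by auto
  have ab: "a i j = ?l' i * ?l' j * b (?t i) (?t j)" if "i \<in> {1..n}" "j \<in> {1..n}" "i \<noteq> j" for i j
  proof -
    have "?t i \<noteq> ?t j" using that(3) st(1) by metis
    then have "b (?t i) (?t j) = l (?t i) * l (?t j) * a i j"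
      using ba[OF t_in[OF that(1)] t_in[OF that(2)]] by (simp add: st)
    then show ?thesis using l[OF t_in[OF that(1)]] l[OF t_in[OF that(2)]] by (simp add: field_simps)
  qed
  have u: "?u i \<in> free_carrier n" and v: "?v i \<in> free_carrier n" if "i \<in> {1..n}" for i
    using s_in[OF that] t_in[OF that] by (auto intro!: free_carrier_mult free_carrier_gen)
  have vu: "substitute ?v (substitute ?u p) = p" if p: "p \<in> free_carrier n" for p
  proof -
    have "substitute ?v (?u i) = gen i" if "i \<in> {1..n}" for i
      using l[OF t_in[OF that]] by (simp add: substitute_mult st scalar_mult mult.assoc [symmetric])
    then show ?thesis unfolding substitute_substitute[OF p] by (rule substitute_eq_self[OF p])
  qed
  have uv: "substitute ?u (substitute ?v p) = p" if p: "p \<in> free_carrier n" for p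
  proof -
    have "substitute ?u (?v i) = gen i" if "i \<in> {1..n}" for i
      using l[OF that] by (simp add: substitute_mult st scalar_mult flip: mult.assoc)
    then show ?thesis unfolding substitute_substitute[OF p] by (rule substitute_eq_self[OF p])
  qed
  have uI: "substitute ?u p \<in> relation_ideal n b" if "p \<in> relation_ideal n a" for p
    by (rule monomial_substitution_relation_ideal[OF b t ab that])
  have vI: "substitute ?v p \<in> relation_ideal n a" if "p \<in> relation_ideal n b" for p
    by (rule monomial_substitution_relation_ideal[OF a s ba that])
  show ?thesis
    unfolding algebra_isomorphic_iff_substitution
  proof (intro exI[of _ ?u] conjI ballI)
    fix p :: "word \<Rightarrow>\<^sub>0 'k" assume p: "p \<in> free_carrier n"
    show "substitute ?u p \<in> relation_ideal n b \<longleftrightarrow> p \<in> relation_ideal n a"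
      using uI[of p] vI[of "substitute ?u p"] unfolding vu[OF p] by blast
    show "\<exists>q\<in>free_carrier n. p - substitute ?u q \<in> relation_ideal n b"
      using free_carrier_substitute[OF p v] uv[OF p] by (intro bexI[of _ "substitute ?v p"]) simp_all
  qed (rule u)
qed

section \<open>Ordered monomials span\<close>

text \<open>
  Exponent vectors are multisets of indices, so that adding exponents is the union of multisets and
  multiplication by a generator adds one element.
\<close>

definition ordered_monomial :: "nat multiset \<Rightarrow> (word \<Rightarrow>\<^sub>0 'k::field)" where
  "ordered_monomial e = Poly_Mapping.single (Word (sorted_list_of_multiset e)) 1"

lemma ordered_monomial_empty [simp]: "ordered_monomial {#} = 1"
  by (simp add: ordered_monomial_def)

lemma ordered_monomial_add_mset:
  assumes "\<And>j. j \<in># e \<Longrightarrow> i \<le> j"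
  shows "ordered_monomial (add_mset i e) = gen i * ordered_monomial e"
proof -
  have "insort i (sorted_list_of_multiset e) = i # sorted_list_of_multiset e"
    using assms by (intro insort_is_Cons) auto
  then show ?thesis by (simp add: ordered_monomial_def single_Word_Cons)
qed

lemma free_carrier_ordered_monomial: "set_mset e \<subseteq> {1..n} \<Longrightarrow> ordered_monomial e \<in> free_carrier n"
  unfolding ordered_monomial_def by (rule free_carrier_single) simp

text \<open>
  Keeping track of the set \<open>X\<close> of letters is what makes the sorting argument work: after a letter has
  moved past a smaller one, that smaller letter must still be a lower bound for what follows it.
\<close>

definition ordered_span :: "nat \<Rightarrow> (nat \<Rightarrow> nat \<Rightarrow> 'k::field) \<Rightarrow> nat set \<Rightarrow> (word \<Rightarrow>\<^sub>0 'k) set" where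
  "ordered_span n a X = {p. \<exists>r. (\<forall>e \<in> Poly_Mapping.keys r. set_mset e \<subseteq> X) \<and>
     p - linear_extension ordered_monomial r \<in> relation_ideal n a}"

lemma ordered_span_ideal: "p \<in> relation_ideal n a \<Longrightarrow> p \<in> ordered_span n a X"
  unfolding ordered_span_def by (intro CollectI exI[of _ 0]) simp

lemma ordered_span_monomial: "set_mset e \<subseteq> X \<Longrightarrow> ordered_monomial e \<in> ordered_span n a X"
  unfolding ordered_span_def
  by (intro CollectI exI[of _ "Poly_Mapping.single e 1"]) simp

lemma ordered_span_add:
  assumes "p \<in> ordered_span n a X" "q \<in> ordered_span n a X"
  shows "p + q \<in> ordered_span n a X"
proof -
  obtain r s where r: "\<forall>e \<in> Poly_Mapping.keys r. set_mset e \<subseteq> X"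
      "p - linear_extension ordered_monomial r \<in> relation_ideal n a"
    and s: "\<forall>e \<in> Poly_Mapping.keys s. set_mset e \<subseteq> X"
      "q - linear_extension ordered_monomial s \<in> relation_ideal n a"
    using assms by (auto simp: ordered_span_def)
  have "p + q - linear_extension ordered_monomial (r + s) \<in> relation_ideal n a"
    using relation_ideal_add[OF r(2) s(2)] by (simp add: linear_extension_add algebra_simps)
  moreover have "\<forall>e \<in> Poly_Mapping.keys (r + s). set_mset e \<subseteq> X"
    using r(1) s(1) Poly_Mapping.keys_add[of r s] by blast
  ultimately show ?thesis by (auto simp: ordered_span_def)
qed

lemma ordered_span_mono: "X \<subseteq> Y \<Longrightarrow> p \<in> ordered_span n a X \<Longrightarrow> p \<in> ordered_span n a Y"
  unfolding ordered_span_def by blast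

lemma ordered_span_scale:
  assumes "p \<in> ordered_span n a X" shows "scalar c * p \<in> ordered_span n a X"
proof -
  obtain r where r: "\<forall>e \<in> Poly_Mapping.keys r. set_mset e \<subseteq> X"
      "p - linear_extension ordered_monomial r \<in> relation_ideal n a"
    using assms by (auto simp: ordered_span_def)
  have "scalar c * p - linear_extension ordered_monomial (Poly_Mapping.single 0 c * r) \<in> relation_ideal n a"
    using relation_ideal_mult_left[OF r(2), of "scalar c"]
    by (simp add: linear_map_scale[OF linear_map_linear_extension] right_diff_distrib scalar_def[symmetric])
  moreover have "\<forall>e \<in> Poly_Mapping.keys (Poly_Mapping.single 0 c * r). set_mset e \<subseteq> X"
    using r(1) by (auto simp: in_keys_iff lookup_scalar_mult)
  ultimately show ?thesis by (auto simp: ordered_span_def)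
qed

lemma ordered_span_sum:
  "(\<And>s. s \<in> S \<Longrightarrow> f s \<in> ordered_span n a X) \<Longrightarrow> sum f S \<in> ordered_span n a X"
  by (induction S rule: infinite_finite_induct) (simp_all add: ordered_span_add ordered_span_ideal)

lemma ordered_span_uminus: "p \<in> ordered_span n a X \<Longrightarrow> - p \<in> ordered_span n a X"
  using ordered_span_scale[of p n a X "- 1"] by (simp add: scalar_def single_uminus)

lemma ordered_span_gen_mult:
  assumes p: "p \<in> ordered_span n a X" and i: "i \<in> {1..n}"
    and mono: "\<And>e. set_mset e \<subseteq> X \<Longrightarrow> gen i * ordered_monomial e \<in> ordered_span n a Y"
  shows "gen i * p \<in> ordered_span n a Y"
proof -
  obtain r where r: "\<forall>e \<in> Poly_Mapping.keys r. set_mset e \<subseteq> X"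
      "p - linear_extension ordered_monomial r \<in> relation_ideal n a"
    using p by (auto simp: ordered_span_def)
  have "gen i * linear_extension ordered_monomial r
      = (\<Sum>e \<in> Poly_Mapping.keys r. scalar (Poly_Mapping.lookup r e) * (gen i * ordered_monomial e))"
    by (simp add: linear_extension_def sum_distrib_left scalar_def mult.assoc [symmetric] single_zero_central)
  then have "gen i * linear_extension ordered_monomial r \<in> ordered_span n a Y"
    using r(1) by (auto intro!: ordered_span_sum ordered_span_scale mono)
  moreover have "gen i * (p - linear_extension ordered_monomial r) \<in> ordered_span n a Y"
    using relation_ideal_mult_left[OF r(2) free_carrier_gen[OF i]] by (rule ordered_span_ideal)
  ultimately have "gen i * linear_extension ordered_monomial r
      + gen i * (p - linear_extension ordered_monomial r) \<in> ordered_span n a Y"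
    by (rule ordered_span_add)
  then show ?thesis by (simp add: right_diff_distrib)
qed

text \<open>
  Let \<open>j\<close> be the first letter of the ordered monomial. If \<open>i > j\<close>, then
  \<open>x\<^sub>i x\<^sub>j W = - x\<^sub>j (x\<^sub>i W) + a W\<close> modulo the relations; by induction \<open>x\<^sub>i W\<close> is a combination of ordered
  monomials in letters that are at least \<open>j\<close>, and putting \<open>x\<^sub>j\<close> in front keeps them ordered.
\<close>

lemma ordered_span_straighten:
  assumes "i \<in> {1..n}" "set_mset e \<subseteq> {1..n}"
  shows "gen i * ordered_monomial e \<in> ordered_span n a (insert i (set_mset e))"
  using assms(2)
proof (induction "size e" arbitrary: e)
  case 0
  then show ?case
    using ordered_span_monomial[of "{#i#}" "{i}" n a] ordered_monomial_add_mset[of "{#}" i, where 'a='a] by simp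
next
  case (Suc k)
  define j where "j = Min (set_mset e)"
  have "e \<noteq> {#}" using Suc.hyps(2) by auto
  then have "j \<in># e" and min: "\<And>l. l \<in># e \<Longrightarrow> j \<le> l"
    by (simp_all add: j_def)
  then obtain e' where e: "e = add_mset j e'" by (meson mset_add)
  then have min': "\<And>l. l \<in># e' \<Longrightarrow> j \<le> l" using min by simp
  have j: "j \<in> {1..n}" using Suc.prems e by simp
  show ?case
  proof (cases "i \<le> j")
    case True
    then have "gen i * ordered_monomial e = (ordered_monomial (add_mset i e) :: word \<Rightarrow>\<^sub>0 'a)"
      using min by (intro ordered_monomial_add_mset[symmetric]) force
    then show ?thesis using ordered_span_monomial[of "add_mset i e" "insert i (set_mset e)" n a] by simp
  next
    case False
    let ?W = "ordered_monomial e'" and ?X = "insert i (set_mset e)"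
    have W: "?W \<in> free_carrier n"
      using Suc.prems e by (intro free_carrier_ordered_monomial) auto
    have IH: "gen i * ?W \<in> ordered_span n a (insert i (set_mset e'))"
      using Suc e by auto
    have "gen j * (gen i * ?W) \<in> ordered_span n a ?X"
    proof (rule ordered_span_gen_mult[OF IH j])
      fix f assume f: "set_mset f \<subseteq> insert i (set_mset e')"
      then have "gen j * ordered_monomial f = (ordered_monomial (add_mset j f) :: word \<Rightarrow>\<^sub>0 'a)"
        using min' False by (intro ordered_monomial_add_mset[symmetric]) force
      then show "gen j * ordered_monomial f \<in> ordered_span n a ?X"
        using f e ordered_span_monomial[of "add_mset j f" ?X] by auto
    qed
    moreover have "scalar (a j i) * ?W \<in> ordered_span n a ?X"
      using e by (intro ordered_span_scale ordered_span_monomial) auto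
    moreover have "(gen j * gen i + gen i * gen j - scalar (a j i)) * ?W \<in> ordered_span n a ?X"
      using False j assms(1) W
      by (intro ordered_span_ideal relation_ideal_mult_right relation_ideal_relation) auto
    ultimately have "- (gen j * (gen i * ?W)) + scalar (a j i) * ?W
        + (gen j * gen i + gen i * gen j - scalar (a j i)) * ?W \<in> ordered_span n a ?X"
      by (intro ordered_span_add ordered_span_uminus)
    moreover have "gen i * (ordered_monomial e :: word \<Rightarrow>\<^sub>0 'a) = gen i * (gen j * ?W)"
      using min' by (simp add: e ordered_monomial_add_mset)
    ultimately show ?thesis
      by (simp add: algebra_simps)
  qed
qed

lemma ordered_span_all:
  assumes "p \<in> free_carrier n" shows "p \<in> ordered_span n a {1..n}"
  using assms
proof (induction rule: free_carrier_induct)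
  case one
  then show ?case using ordered_span_monomial[of "{#}"] by simp
next
  case (gen i p)
  show ?case
  proof (rule ordered_span_gen_mult[OF gen.IH gen.hyps(1)])
    fix e :: "nat multiset" assume "set_mset e \<subseteq> {1..n}"
    then show "gen i * ordered_monomial e \<in> ordered_span n a {1..n}"
      using ordered_span_mono[OF _ ordered_span_straighten[OF gen.hyps(1)], of e "{1..n}"] gen.hyps(1)
      by blast
  qed
qed (simp_all add: ordered_span_ideal ordered_span_add ordered_span_scale)

section \<open>Normal forms\<close>

definition below :: "nat \<Rightarrow> nat multiset \<Rightarrow> nat" where
  "below i f = size (filter_mset (\<lambda>j. j < i) f)"

lemma below_empty [simp]: "below i {#} = 0"
  and below_add_mset [simp]: "below i (add_mset j f) = (if j < i then Suc (below i f) else below i f)"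
  and below_add: "below i (f + g) = below i f + below i g"
  by (simp_all add: below_def)

text \<open>
  The creation and annihilation operators of the Jordan-Wigner representation: the sign accounts for
  moving the letter \<open>i\<close> past all smaller letters. Annihilation is nonzero only on odd multiplicities
  because \<open>x\<^sub>i x\<^sub>j\<^sup>2 = x\<^sub>j\<^sup>2 x\<^sub>i\<close>: pairs of equal letters are passed without any correction term.
\<close>

definition raise :: "nat \<Rightarrow> (nat multiset \<Rightarrow>\<^sub>0 'k::field) \<Rightarrow> (nat multiset \<Rightarrow>\<^sub>0 'k)" where
  "raise i = linear_extension (\<lambda>f. Poly_Mapping.single (add_mset i f) ((- 1) ^ below i f))"

definition lower :: "nat \<Rightarrow> (nat multiset \<Rightarrow>\<^sub>0 'k::field) \<Rightarrow> (nat multiset \<Rightarrow>\<^sub>0 'k)" where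
  "lower i = linear_extension (\<lambda>f. if odd (count f i)
     then Poly_Mapping.single (f - {#i#}) ((- 1) ^ below i f) else 0)"

lemma linear_map_raise: "linear_map (raise i)"
  and linear_map_lower: "linear_map (lower i)"
  by (simp_all add: raise_def lower_def linear_map_linear_extension)

lemma single_empty_mult_single [simp]:
  "Poly_Mapping.single {#} c * Poly_Mapping.single (f :: 'b multiset) (d::'k::field) = Poly_Mapping.single f (c * d)"
  using single_zero_mult_single[of c f d] by simp

lemma raise_single [simp]:
  "raise i (Poly_Mapping.single f c) = Poly_Mapping.single (add_mset i f) ((- 1) ^ below i f * c)"
  by (simp add: raise_def mult.commute)

lemma lower_single:
  "lower i (Poly_Mapping.single f c) =
     (if odd (count f i) then Poly_Mapping.single (f - {#i#}) ((- 1) ^ below i f * c) else 0)"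
  by (simp add: lower_def mult.commute)

lemma lower_add_mset [simp]:
  "lower i (Poly_Mapping.single (add_mset i g) c) =
     (if even (count g i) then Poly_Mapping.single g ((- 1) ^ below i g * c) else 0)"
  by (simp add: lower_single)

lemma lower_notin [simp]: "i \<notin># f \<Longrightarrow> lower i (Poly_Mapping.single f c) = 0"
  by (simp add: lower_single not_in_iff)

lemma single_scale_scale:
  "Poly_Mapping.single {#} c * (Poly_Mapping.single {#} d * m)
     = Poly_Mapping.single ({#} :: 'b multiset) (c * d :: 'k::field) * m"
  by (simp flip: mult.assoc)

lemma lower_lower: "lower i (lower j m) + lower j (lower i m) = 0"
proof (rule linear_map_eqI[of "\<lambda>m. lower i (lower j m) + lower j (lower i m)" "\<lambda>m. 0"])
  show "linear_map (\<lambda>m. lower i (lower j m) + lower j (lower i m))"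
    by (intro linear_map_plus linear_map_compose[OF linear_map_lower linear_map_lower])
  show "linear_map (\<lambda>m :: nat multiset \<Rightarrow>\<^sub>0 'a. 0 :: nat multiset \<Rightarrow>\<^sub>0 'a)"
    by (rule linear_map_const_zero)
  fix f
  show "lower i (lower j (Poly_Mapping.single f 1)) + lower j (lower i (Poly_Mapping.single f (1::'a))) = 0"
  proof (cases "odd (count f i) \<and> odd (count f j) \<and> i \<noteq> j")
    case True
    then have "i \<in># f" "j \<in># f - {#i#}"
      by (auto simp: count_greater_zero_iff [symmetric] simp del: count_greater_zero_iff intro: odd_pos)
    then obtain g where f: "f = add_mset i (add_mset j g)"
      by (metis insert_DiffM)
    have f': "f = add_mset j (add_mset i g)" using f by simp
    have ij: "i \<noteq> j" "j \<noteq> i" "even (count g i)" "even (count g j)"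
      using True f by auto
    have "lower i (lower j (Poly_Mapping.single f (1::'a)))
        = Poly_Mapping.single g ((- 1) ^ below i g * (- 1) ^ below j (add_mset i g))"
      using ij unfolding f' by simp
    moreover have "lower j (lower i (Poly_Mapping.single f (1::'a)))
        = Poly_Mapping.single g ((- 1) ^ below j g * (- 1) ^ below i (add_mset j g))"
      using ij unfolding f by simp
    ultimately show ?thesis using ij
      by (cases "i < j") (auto simp: mult.commute simp flip: single_add)
  qed (auto simp: lower_single linear_map_zero[OF linear_map_lower])
qed

lemma raise_raise:
  assumes "i \<noteq> j" shows "raise i (raise j m) + raise j (raise i m) = 0"
proof (rule linear_map_eqI[of "\<lambda>m. raise i (raise j m) + raise j (raise i m)" "\<lambda>m. 0"])
  show "linear_map (\<lambda>m. raise i (raise j m) + raise j (raise i m))"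
    by (intro linear_map_plus linear_map_compose[OF linear_map_raise linear_map_raise])
  show "linear_map (\<lambda>m :: nat multiset \<Rightarrow>\<^sub>0 'a. 0 :: nat multiset \<Rightarrow>\<^sub>0 'a)"
    by (rule linear_map_const_zero)
  fix f
  show "raise i (raise j (Poly_Mapping.single f 1)) + raise j (raise i (Poly_Mapping.single f (1::'a))) = 0"
    using assms
    by (cases "i < j") (auto simp: mult.commute add_mset_commute simp flip: single_add)
qed

text \<open>
  For \<open>i = j\<close> exactly one of the two products is nonzero on each basis vector, according to the
  parity of the multiplicity of \<open>i\<close>.
\<close>

lemma raise_lower: "raise i (lower j m) + lower j (raise i m) = (if i = j then m else 0)"
proof (rule linear_map_eqI[of "\<lambda>m. raise i (lower j m) + lower j (raise i m)" "\<lambda>m. if i = j then m else 0"])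
  show "linear_map (\<lambda>m. raise i (lower j m) + lower j (raise i m))"
    by (intro linear_map_plus linear_map_compose[OF linear_map_raise linear_map_lower]
        linear_map_compose[OF linear_map_lower linear_map_raise])
  show "linear_map (\<lambda>m :: nat multiset \<Rightarrow>\<^sub>0 'a. if i = j then m else 0)"
    by (simp add: linear_map_def)
  fix f :: "nat multiset"
  let ?k = "Poly_Mapping.single f (1::'a)"
  show "raise i (lower j ?k) + lower j (raise i ?k) = (if i = j then ?k else 0)"
  proof (cases "j \<in># f")
    case False
    then show ?thesis
      by (cases "i = j") (simp_all add: linear_map_zero[OF linear_map_raise] not_in_iff)
  next
    case True
    then obtain g where f: "f = add_mset j g" by (meson mset_add)
    show ?thesis
    proof (cases "i = j")
      case True
      then show ?thesis
        by (simp add: f linear_map_zero[OF linear_map_raise])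
    next
      case False
      then have "lower j (raise i ?k) = (if even (count g j)
          then Poly_Mapping.single (add_mset i g) ((- 1) ^ below j (add_mset i g) * (- 1) ^ below i f) else 0)"
        by (simp add: f add_mset_commute[of i j])
      with False show ?thesis
        by (cases "i < j")
           (auto simp: f linear_map_zero[OF linear_map_raise] mult.commute simp flip: single_add)
    qed
  qed
qed

text \<open>
  Left multiplication by \<open>x\<^sub>j\<close> on ordered monomials. Moving \<open>x\<^sub>j\<close> to its place either carries it past all
  smaller letters, with a sign, or contracts it with some smaller letter \<open>l\<close> to the scalar \<open>a l j\<close>.
\<close>

definition gen_action :: "(nat \<Rightarrow> nat \<Rightarrow> 'k::field) \<Rightarrow> nat \<Rightarrow> (nat multiset \<Rightarrow>\<^sub>0 'k) \<Rightarrow> (nat multiset \<Rightarrow>\<^sub>0 'k)" where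
  "gen_action a j m = raise j m + (\<Sum>l<j. Poly_Mapping.single 0 (a l j) * lower l m)"

lemma linear_map_gen_action: "linear_map (gen_action a j)"
  unfolding gen_action_def
  by (intro linear_map_plus linear_map_sum_maps linear_map_left_mult linear_map_raise linear_map_lower)

lemma gen_action_gen_action:
  "gen_action a i (gen_action a j m) =
     raise i (raise j m) + (\<Sum>l<j. Poly_Mapping.single 0 (a l j) * raise i (lower l m)) +
     (\<Sum>k<i. Poly_Mapping.single 0 (a k i) * lower k (raise j m)) +
     (\<Sum>k<i. \<Sum>l<j. Poly_Mapping.single 0 (a k i * a l j) * lower k (lower l m))"
  by (simp add: gen_action_def linear_map_add[OF linear_map_raise] linear_map_sum[OF linear_map_raise]
      linear_map_scale[OF linear_map_raise, simplified] linear_map_add[OF linear_map_lower]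
      linear_map_sum[OF linear_map_lower] linear_map_scale[OF linear_map_lower, simplified]
      distrib_left sum.distrib sum_distrib_left single_scale_scale add.assoc)

text \<open>
  All anticommutators of creation and annihilation operators vanish except for the one between
  \<open>raise i\<close> and \<open>lower i\<close>. For \<open>i < j\<close> that pair occurs once, in the contraction of \<open>x\<^sub>j\<close> with
  \<open>i\<close>, and contributes \<open>a i j\<close>.
\<close>

lemma gen_action_relation:
  assumes "i < j"
  shows "gen_action a i (gen_action a j m) + gen_action a j (gen_action a i m) = Poly_Mapping.single 0 (a i j) * m"
proof -
  let ?s = "\<lambda>k l. Poly_Mapping.single 0 (a k l) :: nat multiset \<Rightarrow>\<^sub>0 'a"
  have "(\<Sum>l<j. ?s l j * raise i (lower l m)) + (\<Sum>l<j. ?s l j * lower l (raise i m))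
      = (\<Sum>l<j. if i = l then ?s l j * m else 0)"
    unfolding sum.distrib [symmetric] distrib_left [symmetric] raise_lower
    by (intro sum.cong) auto
  also have "\<dots> = ?s i j * m" using assms by simp
  finally have 1: "(\<Sum>l<j. ?s l j * raise i (lower l m)) + (\<Sum>l<j. ?s l j * lower l (raise i m)) = ?s i j * m" .
  have 2: "(\<Sum>k<i. ?s k i * raise j (lower k m)) + (\<Sum>k<i. ?s k i * lower k (raise j m)) = 0"
    unfolding sum.distrib [symmetric] distrib_left [symmetric] raise_lower
    using assms by (intro sum.neutral) auto
  let ?t = "\<lambda>k l. Poly_Mapping.single 0 (a k i * a l j) :: nat multiset \<Rightarrow>\<^sub>0 'a"
  let ?t' = "\<lambda>l k. Poly_Mapping.single 0 (a l j * a k i) :: nat multiset \<Rightarrow>\<^sub>0 'a"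
  have "(\<Sum>l<j. \<Sum>k<i. ?t' l k * lower l (lower k m)) = (\<Sum>k<i. \<Sum>l<j. ?t k l * lower l (lower k m))"
    by (subst sum.swap) (simp add: mult.commute)
  then have 3: "(\<Sum>k<i. \<Sum>l<j. ?t k l * lower k (lower l m))
      + (\<Sum>l<j. \<Sum>k<i. ?t' l k * lower l (lower k m)) = 0"
    by (simp only: sum.distrib [symmetric] distrib_left [symmetric] lower_lower) simp
  have "gen_action a i (gen_action a j m) + gen_action a j (gen_action a i m)
     = (raise i (raise j m) + raise j (raise i m))
     + ((\<Sum>l<j. ?s l j * raise i (lower l m)) + (\<Sum>l<j. ?s l j * lower l (raise i m)))
     + ((\<Sum>k<i. ?s k i * raise j (lower k m)) + (\<Sum>k<i. ?s k i * lower k (raise j m)))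
     + ((\<Sum>k<i. \<Sum>l<j. ?t k l * lower k (lower l m))
      + (\<Sum>l<j. \<Sum>k<i. ?t' l k * lower l (lower k m)))"
    unfolding gen_action_gen_action by (simp only: add_ac)
  also have "\<dots> = ?s i j * m"
    using assms unfolding 1 2 3 by (simp add: raise_raise)
  finally show ?thesis .
qed

text \<open>
  The result of applying \<open>p\<close> to the vacuum vector, which is the basis vector of the empty multiset
  and at the same time the unit \<open>1\<close> of the convolution product.
\<close>

definition normal_form :: "(nat \<Rightarrow> nat \<Rightarrow> 'k::field) \<Rightarrow> (word \<Rightarrow>\<^sub>0 'k) \<Rightarrow> (nat multiset \<Rightarrow>\<^sub>0 'k)" where
  "normal_form a p = represent (gen_action a) p 1"

lemma represent_gen_action_ideal:
  "p \<in> relation_ideal n a \<Longrightarrow> represent (gen_action a) p m = 0"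
  by (erule represent_relation_ideal) (simp_all add: linear_map_gen_action gen_action_relation)

lemma foldr_gen_action_sorted:
  "sorted is \<Longrightarrow> foldr (gen_action a) is 1 = Poly_Mapping.single (mset is) 1"
proof (induction "is")
  case (Cons i "is")
  then have *: "j \<notin> set is" if "j < i" for j using that by auto
  then have "below i (mset is) = 0"
    by (auto simp: below_def size_eq_0_iff_empty)
  moreover have "(\<Sum>l<i. Poly_Mapping.single 0 (a l i) * lower l (Poly_Mapping.single (mset is) 1)) = 0"
    using * by (intro sum.neutral) simp
  ultimately show ?case using Cons by (simp add: gen_action_def)
qed (simp flip: single_one)

lemma normal_form_ordered_monomial [simp]:
  "normal_form a (ordered_monomial e) = Poly_Mapping.single e 1"
  by (simp add: normal_form_def ordered_monomial_def foldr_gen_action_sorted)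

lemma linear_map_normal_form: "linear_map (normal_form a)"
  using linear_map_represent_left[of "gen_action a" 1] by (simp add: normal_form_def[abs_def])

text \<open>
  The Poincare-Birkhoff-Witt theorem for these algebras: some combination of ordered monomials is
  congruent to \<open>p\<close>, and applying it to the vacuum recovers its coefficients.
\<close>

theorem normal_form:
  assumes "p \<in> free_carrier n"
  shows "p - linear_extension ordered_monomial (normal_form a p) \<in> relation_ideal n a"
    and "\<And>e. e \<in> Poly_Mapping.keys (normal_form a p) \<Longrightarrow> set_mset e \<subseteq> {1..n}"
proof -
  obtain r where r: "\<forall>e \<in> Poly_Mapping.keys r. set_mset e \<subseteq> {1..n}"
      "p - linear_extension ordered_monomial r \<in> relation_ideal n a"
    using ordered_span_all[OF assms, of a] by (auto simp: ordered_span_def)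
  have "normal_form a p - normal_form a (linear_extension ordered_monomial r) = 0"
    using represent_gen_action_ideal[OF r(2), of 1]
    by (simp add: represent_diff normal_form_def)
  moreover have "normal_form a (linear_extension ordered_monomial r) = r"
    using linear_map_eqI[OF linear_map_compose[OF linear_map_normal_form[of a]
          linear_map_linear_extension[of ordered_monomial]] linear_map_ident, of r]
    by simp
  ultimately have "normal_form a p = r" by simp
  with r show "p - linear_extension ordered_monomial (normal_form a p) \<in> relation_ideal n a"
    "\<And>e. e \<in> Poly_Mapping.keys (normal_form a p) \<Longrightarrow> set_mset e \<subseteq> {1..n}" by auto
qed

section \<open>Leading exponents\<close>

text \<open>
  Comparing these pairs lexicographically is the degree-lexicographic order. Within one degree any
  total order compatible with addition would do; the multiset order is such an order.
\<close>

definition deglex :: "nat multiset \<Rightarrow> nat \<times> nat multiset" where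
  "deglex e = (size e, e)"

lemma deglex_eq_iff [simp]: "deglex e = deglex f \<longleftrightarrow> e = f"
  by (auto simp: deglex_def)

lemma deglex_add_less [simp]: "deglex (e + g) < deglex (f + g) \<longleftrightarrow> deglex e < deglex f"
  by (auto simp: deglex_def less_prod_def')

lemma deglex_add_less' [simp]: "deglex (g + e) < deglex (g + f) \<longleftrightarrow> deglex e < deglex f"
  by (metis deglex_add_less add.commute)

lemma deglex_size_less: "size e < size f \<Longrightarrow> deglex e < deglex f"
  by (simp add: deglex_def less_prod_def')

lemma deglex_size_le: "deglex e \<le> deglex f \<Longrightarrow> size e \<le> size f"
  by (auto simp: deglex_def less_eq_prod_def)

definition lower_terms :: "nat multiset \<Rightarrow> (nat multiset \<Rightarrow>\<^sub>0 'k::field) set" where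
  "lower_terms e = {m. \<forall>k \<in> Poly_Mapping.keys m. deglex k < deglex e}"

lemma lower_terms_zero [simp]: "0 \<in> lower_terms e"
  by (simp add: lower_terms_def)

lemma lower_terms_add: "m \<in> lower_terms e \<Longrightarrow> m' \<in> lower_terms e \<Longrightarrow> m + m' \<in> lower_terms e"
  using Poly_Mapping.keys_add[of m m'] by (auto simp: lower_terms_def)

lemma lower_terms_scale: "m \<in> lower_terms e \<Longrightarrow> Poly_Mapping.single 0 c * m \<in> lower_terms e"
  by (auto simp: lower_terms_def in_keys_iff lookup_scalar_mult simp del: empty_neutral)

lemma lower_terms_sum:
  "(\<And>x. x \<in> S \<Longrightarrow> f x \<in> lower_terms e) \<Longrightarrow> sum f S \<in> lower_terms e"
  by (induction S rule: infinite_finite_induct) (simp_all add: lower_terms_add)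

lemma lower_terms_single: "deglex f < deglex e \<Longrightarrow> Poly_Mapping.single f c \<in> lower_terms e"
  by (simp add: lower_terms_def)

lemma lower_terms_less: "m \<in> lower_terms e \<Longrightarrow> deglex e < deglex f \<Longrightarrow> m \<in> lower_terms f"
  by (force simp: lower_terms_def)

text \<open>
  The number of inversions when the letters of \<open>e\<close> are written in front of those of \<open>f\<close>. It is
  biadditive.
\<close>

definition crossings :: "nat multiset \<Rightarrow> nat multiset \<Rightarrow> nat" where
  "crossings e f = (\<Sum>i\<in>#e. below i f)"

lemma crossings_empty [simp]: "crossings {#} f = 0" "crossings e {#} = 0"
  and crossings_add_left: "crossings (e + e') f = crossings e f + crossings e' f"
  and crossings_add_right: "crossings e (f + f') = crossings e f + crossings e f'"
  by (simp_all add: crossings_def below_add sum_mset.distrib)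

text \<open>
  The leading term of \<open>p\<close> as an operator on all basis vectors, not only on the vacuum; this is the
  form that is closed under products. The coefficient \<open>c\<close> may be zero, in which case \<open>p\<close> has only
  terms below \<open>e\<close>.
\<close>

definition leading :: "(nat \<Rightarrow> nat \<Rightarrow> 'k::field) \<Rightarrow> (word \<Rightarrow>\<^sub>0 'k) \<Rightarrow> nat multiset \<Rightarrow> 'k \<Rightarrow> bool" where
  "leading a p e c \<longleftrightarrow> (\<forall>f. represent (gen_action a) p (Poly_Mapping.single f 1)
     - Poly_Mapping.single (e + f) (c * (- 1) ^ crossings e f) \<in> lower_terms (e + f))"

lemma leadingE:
  assumes "leading a p e c"
  obtains m where "m \<in> lower_terms (e + f)"
    "represent (gen_action a) p (Poly_Mapping.single f 1)
       = Poly_Mapping.single (e + f) (c * (- 1) ^ crossings e f) + m"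
  using assms[unfolded leading_def, rule_format, of f] by (metis diff_add_cancel add.commute)

lemma leading_lower_terms:
  assumes "leading a p e c" "m \<in> lower_terms g"
  shows "represent (gen_action a) p m \<in> lower_terms (e + g)"
proof -
  have "represent (gen_action a) p (Poly_Mapping.single k 1) \<in> lower_terms (e + g)"
    if "k \<in> Poly_Mapping.keys m" for k
  proof -
    have k: "deglex k < deglex g" using that assms(2) by (simp add: lower_terms_def)
    obtain r where "r \<in> lower_terms (e + k)"
      "represent (gen_action a) p (Poly_Mapping.single k 1)
         = Poly_Mapping.single (e + k) (c * (- 1) ^ crossings e k) + r"
      using leadingE[OF assms(1)] by metis
    with k show ?thesis
      by (auto intro!: lower_terms_add lower_terms_single intro: lower_terms_less)
  qed
  moreover have lin: "linear_map (represent (gen_action a) p)"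
    by (rule linear_map_represent[OF linear_map_gen_action])
  ultimately show ?thesis
    unfolding linear_map_eq_linear_extension[OF lin, of m]
      linear_extension_def
    by (intro lower_terms_sum lower_terms_scale)
qed

text \<open>
  Both factors act on basis vectors by shifting the exponent, up to lower terms, and biadditivity of
  the number of inversions combines the two signs.
\<close>

lemma leading_mult:
  assumes p: "leading a p e c" and q: "leading a q f d"
  shows "leading a (p * q) (e + f) (c * d * (- 1) ^ crossings e f)"
  unfolding leading_def
proof
  fix g
  let ?R = "represent (gen_action a)"
  have lin: "linear_map (?R p)"
    by (rule linear_map_represent[OF linear_map_gen_action])
  obtain r where r: "r \<in> lower_terms (f + g)"
    "?R q (Poly_Mapping.single g 1) = Poly_Mapping.single (f + g) (d * (- 1) ^ crossings f g) + r"
    using leadingE[OF q] by metis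
  obtain s where s: "s \<in> lower_terms (e + (f + g))"
    "?R p (Poly_Mapping.single (f + g) 1)
       = Poly_Mapping.single (e + (f + g)) (c * (- 1) ^ crossings e (f + g)) + s"
    using leadingE[OF p] by metis
  let ?d = "d * (- 1) ^ crossings f g"
  have "?R (p * q) (Poly_Mapping.single g 1)
      = ?R p (Poly_Mapping.single 0 ?d * Poly_Mapping.single (f + g) 1) + ?R p r"
    by (simp add: represent_mult linear_map_gen_action r(2) linear_map_add[OF lin])
  also have "\<dots> = Poly_Mapping.single 0 ?d * Poly_Mapping.single (e + (f + g)) (c * (- 1) ^ crossings e (f + g))
      + Poly_Mapping.single 0 ?d * s + ?R p r"
    unfolding linear_map_scale[OF lin] s(2) by (simp add: distrib_left)
  also have "Poly_Mapping.single 0 ?d * Poly_Mapping.single (e + (f + g)) (c * (- 1) ^ crossings e (f + g))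
      = Poly_Mapping.single (e + f + g) (c * d * (- 1) ^ crossings e f * (- 1) ^ crossings (e + f) g)"
    by (simp add: crossings_add_left crossings_add_right power_add add.assoc mult_ac)
  finally have "?R (p * q) (Poly_Mapping.single g 1)
      - Poly_Mapping.single (e + f + g) (c * d * (- 1) ^ crossings e f * (- 1) ^ crossings (e + f) g)
      = Poly_Mapping.single 0 ?d * s + ?R p r"
    by simp
  moreover have "\<dots> \<in> lower_terms (e + (f + g))"
    by (intro lower_terms_add lower_terms_scale s(1) leading_lower_terms[OF p r(1)])
  ultimately show "?R (p * q) (Poly_Mapping.single g 1)
      - Poly_Mapping.single (e + f + g) (c * d * (- 1) ^ crossings e f * (- 1) ^ crossings (e + f) g)
      \<in> lower_terms (e + f + g)"
    by (simp add: add.assoc)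
qed

lemma leading_add:
  assumes "leading a p e c" "leading a q e d" shows "leading a (p + q) e (c + d)"
  unfolding leading_def
proof
  fix f
  have "represent (gen_action a) (p + q) (Poly_Mapping.single f 1)
       - Poly_Mapping.single (e + f) ((c + d) * (- 1) ^ crossings e f)
     = (represent (gen_action a) p (Poly_Mapping.single f 1) - Poly_Mapping.single (e + f) (c * (- 1) ^ crossings e f))
     + (represent (gen_action a) q (Poly_Mapping.single f 1) - Poly_Mapping.single (e + f) (d * (- 1) ^ crossings e f))"
    by (simp add: represent_add single_add distrib_right)
  also have "\<dots> \<in> lower_terms (e + f)"
    using assms by (intro lower_terms_add) (simp_all add: leading_def)
  finally show "represent (gen_action a) (p + q) (Poly_Mapping.single f 1)
       - Poly_Mapping.single (e + f) ((c + d) * (- 1) ^ crossings e f) \<in> lower_terms (e + f)" .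
qed

lemma leading_scalar: "leading a (scalar c) {#} c"
  by (simp add: leading_def)

lemma leading_scale: "leading a p e c \<Longrightarrow> leading a (scalar d * p) e (d * c)"
  using leading_mult[OF leading_scalar] by simp

lemma leading_less:
  assumes "leading a p e c" "deglex e < deglex f" shows "leading a p f 0"
  unfolding leading_def
proof
  fix g
  obtain m where "m \<in> lower_terms (e + g)"
    "represent (gen_action a) p (Poly_Mapping.single g 1)
       = Poly_Mapping.single (e + g) (c * (- 1) ^ crossings e g) + m"
    using leadingE[OF assms(1)] by metis
  then show "represent (gen_action a) p (Poly_Mapping.single g 1)
      - Poly_Mapping.single (f + g) (0 * (- 1) ^ crossings f g) \<in> lower_terms (f + g)"
    using assms(2) by (auto intro!: lower_terms_add lower_terms_single intro: lower_terms_less)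
qed

lemma leading_zero: "leading a 0 e 0"
  by (simp add: leading_def represent_zero)

lemma leading_sum_zero:
  "(\<And>s. s \<in> S \<Longrightarrow> leading a (g s) e 0) \<Longrightarrow> leading a (sum g S) e 0"
proof (induction S rule: infinite_finite_induct)
  case (insert x S)
  then show ?case using leading_add[of a "g x" e 0 "sum g S" 0] by simp
qed (simp_all add: leading_zero)

lemma leading_gen: "leading a (gen i) {#i#} 1"
  unfolding leading_def
proof
  fix f
  have "Poly_Mapping.single 0 (a l i) * lower l (Poly_Mapping.single f 1) \<in> lower_terms ({#i#} + f)" for l
  proof (cases "l \<in># f")
    case True
    then show ?thesis
      by (intro lower_terms_scale)
         (auto simp: lower_single size_Diff_singleton intro!: lower_terms_single deglex_size_less)
  qed simp
  then have "(\<Sum>l<i. Poly_Mapping.single 0 (a l i) * lower l (Poly_Mapping.single f 1)) \<in> lower_terms ({#i#} + f)"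
    by (intro lower_terms_sum)
  then show "represent (gen_action a) (gen i) (Poly_Mapping.single f 1)
      - Poly_Mapping.single ({#i#} + f) (1 * (- 1) ^ crossings {#i#} f) \<in> lower_terms ({#i#} + f)"
    by (simp add: gen_action_def crossings_def)
qed

lemma leading_cong:
  assumes "p - q \<in> relation_ideal n a" "leading a p e c" shows "leading a q e c"
  using assms(2) represent_gen_action_ideal[OF assms(1)]
  by (simp add: leading_def represent_diff)

text \<open>Apply \<open>p\<close> to the vacuum, where there are no inversions.\<close>

lemma leading_lookup_normal_form:
  assumes "leading a p e c"
  shows "Poly_Mapping.lookup (normal_form a p) e = c"
    and "k \<in> Poly_Mapping.keys (normal_form a p) \<Longrightarrow> deglex k \<le> deglex e"
proof -
  obtain m where m: "m \<in> lower_terms e" "normal_form a p = Poly_Mapping.single e c + m"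
    using leadingE[OF assms, of "{#}"] by (auto simp: normal_form_def)
  then have "e \<notin> Poly_Mapping.keys m" by (auto simp: lower_terms_def)
  then show "Poly_Mapping.lookup (normal_form a p) e = c"
    by (simp add: m(2) lookup_add in_keys_iff)
  show "deglex k \<le> deglex e" if "k \<in> Poly_Mapping.keys (normal_form a p)"
    using that m Poly_Mapping.keys_add[of "Poly_Mapping.single e c" m]
    by (fastforce simp: lower_terms_def split: if_splits)
qed

lemma leading_unique:
  assumes "leading a p e c" "c \<noteq> 0" "leading a p f d" "d \<noteq> 0"
  shows "e = f"
proof -
  have "e \<in> Poly_Mapping.keys (normal_form a p)" "f \<in> Poly_Mapping.keys (normal_form a p)"
    using assms leading_lookup_normal_form(1) by (auto simp: in_keys_iff)
  then show ?thesis
    using leading_lookup_normal_form(2)[OF assms(1)] leading_lookup_normal_form(2)[OF assms(3)]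
    by (metis antisym deglex_eq_iff)
qed

lemma normal_form_ideal: "p \<in> relation_ideal n a \<Longrightarrow> normal_form a p = 0"
  by (simp add: normal_form_def represent_gen_action_ideal)

text \<open>
  Since the exponents are different, a single summand attains the largest one, and it cannot be
  cancelled.
\<close>

lemma leading_combination:
  assumes "finite S" "S \<noteq> {}" "inj_on E S"
    and lead: "\<And>s. s \<in> S \<Longrightarrow> \<exists>c. c \<noteq> 0 \<and> leading a (g s) (E s) c"
    and r: "\<And>s. s \<in> S \<Longrightarrow> r s \<noteq> 0"
  shows "\<exists>s\<in>S. \<exists>c. c \<noteq> 0 \<and> leading a (\<Sum>s\<in>S. scalar (r s) * g s) (E s) c"
proof -
  have "Max ((\<lambda>s. deglex (E s)) ` S) \<in> (\<lambda>s. deglex (E s)) ` S"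
    using assms(1,2) by (intro Max_in) auto
  then obtain s where s: "s \<in> S" "\<And>t. t \<in> S \<Longrightarrow> deglex (E t) \<le> deglex (E s)"
    using Max_ge[of "(\<lambda>s. deglex (E s)) ` S"] assms(1) by fastforce
  have "leading a (scalar (r t) * g t) (E s) 0" if t: "t \<in> S - {s}" for t
  proof -
    have "E t \<noteq> E s" using t s(1) assms(3) by (auto dest: inj_onD)
    then have "deglex (E t) < deglex (E s)" using s(2)[of t] t by (simp add: order_less_le)
    moreover obtain c where "leading a (g t) (E t) c" using lead t by blast
    ultimately show ?thesis by (blast intro: leading_less leading_scale)
  qed
  then have rest: "leading a (\<Sum>t\<in>S - {s}. scalar (r t) * g t) (E s) 0"
    by (rule leading_sum_zero)
  obtain c where c: "c \<noteq> 0" "leading a (g s) (E s) c" using lead s(1) by blast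
  have "leading a (\<Sum>t\<in>S. scalar (r t) * g t) (E s) (r s * c)"
    using leading_add[OF leading_scale[OF c(2), of "r s"] rest] assms(1) s(1)
    by (simp add: sum.remove)
  with s(1) c(1) r[OF s(1)] show ?thesis by (intro bexI[of _ s] exI[of _ "r s * c"]) auto
qed

lemma leading_substitute_word:
  assumes "\<And>i. i \<in> set is \<Longrightarrow> \<exists>c. c \<noteq> 0 \<and> leading a (u i) (E i) c"
  shows "\<exists>c. c \<noteq> 0 \<and> leading a (substitute u (Poly_Mapping.single (Word is) 1)) (\<Sum>i\<in>#mset is. E i) c"
  using assms
proof (induction "is")
  case Nil
  then show ?case using leading_scalar[of a 1] by (intro exI[of _ 1]) (simp add: scalar_def)
next
  case (Cons i "is")
  obtain c where c: "c \<noteq> 0" "leading a (substitute u (Poly_Mapping.single (Word is) 1)) (\<Sum>i\<in>#mset is. E i) c"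
    using Cons by auto
  obtain d where d: "d \<noteq> 0" "leading a (u i) (E i) d" using Cons.prems by auto
  from leading_mult[OF d(2) c(2)] c(1) d(1) show ?case
    by (intro exI[of _ "d * c * (- 1) ^ crossings (E i) (\<Sum>i\<in>#mset is. E i)"])
       (simp add: single_Word_Cons substitute_mult)
qed

lemma substitute_gen_id: "substitute gen p = p"
proof -
  have "substitute gen (Poly_Mapping.single (Word is) (1::'a)) = Poly_Mapping.single (Word is) 1" for "is"
    by (induction "is") (simp_all add: single_Word_Cons substitute_mult)
  then have "substitute gen (Poly_Mapping.single w (1::'a)) = Poly_Mapping.single w 1" for w
    by (cases w) simp
  then show ?thesis
    using linear_map_eqI[OF linear_map_substitute linear_map_ident, of gen p] by blast
qed

lemma leading_substitute_ordered_monomial: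
  assumes "\<And>i. i \<in># e \<Longrightarrow> \<exists>c. c \<noteq> 0 \<and> leading a (u i) (E i) c"
  shows "\<exists>c. c \<noteq> 0 \<and> leading a (substitute u (ordered_monomial e)) (\<Sum>i\<in>#e. E i) c"
  using leading_substitute_word[of "sorted_list_of_multiset e" a u E] assms
  by (simp add: ordered_monomial_def)

text \<open>
  Write \<open>p\<close> as a combination of ordered monomials. After the substitution their leading exponents are
  the sums \<open>\<Sum> m\<^sub>i E\<^sub>i\<close>, which are different by assumption, so that the largest of them survives.
\<close>

lemma leading_substitute:
  assumes p: "p \<in> free_carrier n" and nz: "normal_form a p \<noteq> 0"
    and u: "\<And>i. i \<in> {1..n} \<Longrightarrow> \<exists>c. c \<noteq> 0 \<and> leading b (u i) (E i) c"
    and ideal: "\<And>q. q \<in> relation_ideal n a \<Longrightarrow> substitute u q \<in> relation_ideal n b"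
    and inj: "inj_on (\<lambda>e. \<Sum>i\<in>#e. E i) {e. set_mset e \<subseteq> {1..n}}"
  shows "\<exists>e c. set_mset e \<subseteq> {1..n} \<and> c \<noteq> 0 \<and> leading b (substitute u p) (\<Sum>i\<in>#e. E i) c"
proof -
  let ?r = "normal_form a p"
  have letters: "set_mset e \<subseteq> {1..n}" if "e \<in> Poly_Mapping.keys ?r" for e
    using normal_form(2)[OF p that] .
  have "\<exists>e\<in>Poly_Mapping.keys ?r. \<exists>c. c \<noteq> 0 \<and>
      leading b (\<Sum>e\<in>Poly_Mapping.keys ?r. scalar (Poly_Mapping.lookup ?r e) * substitute u (ordered_monomial e))
        (\<Sum>i\<in>#e. E i) c"
    using letters u nz
    by (intro leading_combination leading_substitute_ordered_monomial inj_on_subset[OF inj])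
       (auto simp: in_keys_iff subset_iff)
  then obtain e c where ec: "e \<in> Poly_Mapping.keys ?r" "c \<noteq> 0"
    "leading b (\<Sum>e\<in>Poly_Mapping.keys ?r. scalar (Poly_Mapping.lookup ?r e) * substitute u (ordered_monomial e))
        (\<Sum>i\<in>#e. E i) c" by blast
  have "substitute u (linear_extension ordered_monomial ?r)
      = (\<Sum>e\<in>Poly_Mapping.keys ?r. scalar (Poly_Mapping.lookup ?r e) * substitute u (ordered_monomial e))"
    by (simp add: linear_extension_def substitute_sum substitute_scale scalar_def)
  moreover have "substitute u (linear_extension ordered_monomial ?r) - substitute u p \<in> relation_ideal n b"
    using relation_ideal_uminus[OF ideal[OF normal_form(1)[OF p, of a]]]
    by (simp add: substitute_diff)
  ultimately have "leading b (substitute u p) (\<Sum>i\<in>#e. E i) c"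
    using ec(3) leading_cong by metis
  with ec letters show ?thesis by blast
qed

lemma leading_exists:
  assumes "p \<in> free_carrier n" "normal_form a p \<noteq> 0"
  shows "\<exists>e c. c \<noteq> 0 \<and> leading a p e c"
proof -
  have "\<exists>e c. set_mset e \<subseteq> {1..n} \<and> c \<noteq> 0 \<and> leading a (substitute gen p) (\<Sum>i\<in>#e. {#i#}) c"
    using assms
    by (intro leading_substitute) (auto simp: substitute_gen_id intro: leading_gen exI[of _ 1] inj_onI)
  then show ?thesis by (auto simp: substitute_gen_id)
qed

text \<open>
  The products \<open>p q\<close> and \<open>q p\<close> have the same leading exponent and, up to sign, the same leading
  coefficient. If the signs were equal, their sum would have a leading term of positive degree with
  coefficient \<open>\<plusminus>2 c d\<close>.
\<close>

lemma leading_anticommute: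
  fixes c d :: "'k::field"
  assumes p: "leading a p e c" "c \<noteq> 0" and q: "leading a q f d" "d \<noteq> 0"
    and rel: "p * q + q * p - scalar x \<in> relation_ideal n a"
    and ef: "e + f \<noteq> {#}" and two: "(2::'k) \<noteq> 0"
  shows "odd (crossings e f + crossings f e)"
proof
  assume even: "even (crossings e f + crossings f e)"
  have "leading a (p * q + q * p) (e + f)
      (c * d * (- 1) ^ crossings e f + d * c * (- 1) ^ crossings f e)"
    using leading_mult[OF q(1) p(1)] by (intro leading_add leading_mult[OF p(1) q(1)]) (simp add: add.commute)
  moreover have "deglex {#} < deglex (e + f)"
    using ef by (intro deglex_size_less) (simp add: nonempty_has_size)
  then have "leading a (scalar (- x)) (e + f) 0"
    by (rule leading_less[OF leading_scalar])
  ultimately have "leading a (p * q + q * p + scalar (- x)) (e + f)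
      (c * d * (- 1) ^ crossings e f + d * c * (- 1) ^ crossings f e + 0)"
    by (rule leading_add)
  then have "c * d * (- 1) ^ crossings e f + d * c * (- 1) ^ crossings f e = 0"
    using normal_form_ideal[OF rel] leading_lookup_normal_form(1)
    by (fastforce simp: scalar_def single_uminus)
  moreover have "(- 1 :: 'k) ^ crossings f e = (- 1) ^ crossings e f"
    using even by (auto simp: minus_one_power_iff)
  moreover have "2 * (c * d * z) = c * d * z + d * c * z" for z :: 'k
    by (simp add: mult.commute)
  ultimately have "2 * (c * d * (- 1) ^ crossings e f) = 0"
    by metis
  with p(2) q(2) two show False by simp
qed

section \<open>Linear independence from parity\<close>

lemma even_multiset_half:
  assumes "\<And>x. even (count m x)"
  shows "\<exists>k. m = k + k"
  using assms
proof (induction "size m" arbitrary: m rule: less_induct)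
  case less
  show ?case
  proof (cases "m = {#}")
    case False
    then obtain x where x: "x \<in># m" by blast
    then have "count m x \<noteq> 0" by (simp add: count_eq_zero_iff)
    then have "count m x \<ge> 2" using less.prems[of x] by presburger
    then have sub: "{#x, x#} \<subseteq># m" by (simp add: subseteq_mset_def)
    define m' where "m' = m - {#x, x#}"
    have m: "m = m' + {#x, x#}" using subset_mset.diff_add[OF sub] by (simp only: m'_def)
    have "even (count m' y)" for y
      using less.prems[of y] by (auto simp: m split: if_splits)
    then obtain k where "m' = k + k" using less.hyps[of m'] m by auto
    then have "m = add_mset x k + add_mset x k" by (simp add: m)
    then show ?thesis by blast
  qed simp
qed

text \<open>
  Let \<open>\<omega>\<close> be the form \<open>crossings e f + crossings f e\<close> modulo 2, which vanishes for \<open>e = f\<close>. Pairing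
  \<open>\<Sum> m\<^sub>i E\<^sub>i\<close> with \<open>E\<^sub>j\<close> determines \<open>|m| + m\<^sub>j\<close> modulo 2. If \<open>m\<close> and \<open>m'\<close> give the same sum, then all
  numbers \<open>m\<^sub>j + m'\<^sub>j\<close> have the parity of their total \<open>s\<close>; as there are evenly many of them, \<open>s\<close> and hence
  each of them is even. Common elements of \<open>m\<close> and \<open>m'\<close> can be cancelled; if there are none, then all
  multiplicities are even and both multisets can be halved, so that an infinite descent applies.
\<close>

lemma sum_mset_inj_of_odd_crossings:
  fixes E :: "nat \<Rightarrow> nat multiset"
  assumes "even n"
    and odd: "\<And>i j. i \<in> {1..n} \<Longrightarrow> j \<in> {1..n} \<Longrightarrow> i \<noteq> j \<Longrightarrow>
      odd (crossings (E i) (E j) + crossings (E j) (E i))"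
  shows "inj_on (\<lambda>m. \<Sum>i\<in>#m. E i) {m. set_mset m \<subseteq> {1..n}}"
proof -
  have parity: "even (crossings (E j) (\<Sum>i\<in>#m. E i) + crossings (\<Sum>i\<in>#m. E i) (E j)) \<longleftrightarrow>
      even (size m + count m j)" if "set_mset m \<subseteq> {1..n}" "j \<in> {1..n}" for m j
    using that(1)
  proof (induction m)
    case (add i m)
    then show ?case
      using odd[of i j] that(2)
      by (cases "i = j") (auto simp: crossings_add_left crossings_add_right)
  qed simp
  have "m = m'" if "set_mset m \<subseteq> {1..n}" "set_mset m' \<subseteq> {1..n}" "(\<Sum>i\<in>#m. E i) = (\<Sum>i\<in>#m'. E i)" for m m'
    using that
  proof (induction "size m + size m'" arbitrary: m m' rule: less_induct)
    case less
    let ?s = "size m + size m'"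
    have par: "even (count m j + count m' j) \<longleftrightarrow> even ?s" if "j \<in> {1..n}" for j
      using parity[OF less.prems(1) that] parity[OF less.prems(2) that] less.prems(3) by auto
    have size: "size k = (\<Sum>j\<in>{1..n}. count k j)" if "set_mset k \<subseteq> {1..n}" for k
      unfolding size_multiset_overloaded_eq using that
      by (intro sum.mono_neutral_left) (auto simp: not_in_iff)
    have "?s = (\<Sum>j\<in>{1..n}. count m j + count m' j)"
      unfolding size[OF less.prems(1)] size[OF less.prems(2)] sum.distrib ..
    moreover have "even (\<Sum>j\<in>{1..n}. count m j + count m' j)"
    proof (cases "even ?s")
      case True
      then show ?thesis using par by (intro dvd_sum) blast
    next
      case False
      then have "{j \<in> {1..n}. odd (count m j + count m' j)} = {1..n}" using par by blast
      then show ?thesis using \<open>even n\<close> by (simp only: even_sum_iff[OF finite_atLeastAtMost]) simp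
    qed
    ultimately have "even ?s" by simp
    have even: "even (count m j + count m' j)" for j
    proof (cases "j \<in> {1..n}")
      case False
      then have "j \<notin># m" "j \<notin># m'" using less.prems(1,2) by blast+
      then show ?thesis by (simp add: not_in_iff)
    qed (use par \<open>even ?s\<close> in blast)
    show ?case
    proof (cases "set_mset m \<inter> set_mset m' = {}")
      case False
      then obtain x k k' where m: "m = add_mset x k" "m' = add_mset x k'"
        by (metis disjoint_iff mset_add)
      then show ?thesis using less.hyps[of k k'] less.prems by simp
    next
      case True
      then have disj: "count m j = 0 \<or> count m' j = 0" for j
        by (auto simp: count_eq_zero_iff)
      have "even (count m j)" "even (count m' j)" for j
        using even[of j] disj[of j] by auto
      then obtain k k' where k: "m = k + k" "m' = k' + k'"
        using even_multiset_half[of m] even_multiset_half[of m'] by blast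
      let ?S = "\<Sum>i\<in>#k. E i" and ?S' = "\<Sum>i\<in>#k'. E i"
      have "?S + ?S = ?S' + ?S'" using less.prems(3) by (simp add: k)
      then have "?S = ?S'"
        by (metis multiset_eqI count_union add_self_div_2)
      show ?thesis
      proof (cases "m = {#} \<and> m' = {#}")
        case False
        then have "k = k'"
          using less.hyps[of k k'] less.prems \<open>?S = ?S'\<close> by (auto simp: k nonempty_has_size)
        then show ?thesis by (simp add: k)
      qed simp
    qed
  qed
  then show ?thesis by (auto simp: inj_on_def)
qed

section \<open>Images of the generators\<close>

lemma normal_form_gen [simp]: "normal_form a (gen i) = Poly_Mapping.single {#i#} 1"
  using normal_form_ordered_monomial[of a "{#i#}"] ordered_monomial_add_mset[of "{#}" i, where 'a = 'a]
  by (simp del: normal_form_ordered_monomial)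

lemma normal_form_scalar [simp]: "normal_form a (scalar c) = Poly_Mapping.single {#} c"
  by (simp add: normal_form_def)

lemmas normal_form_add = linear_map_add [OF linear_map_normal_form]
  and normal_form_diff = linear_map_diff [OF linear_map_normal_form]
  and normal_form_sum = linear_map_sum [OF linear_map_normal_form]

lemma normal_form_scale: "normal_form a (scalar c * p) = Poly_Mapping.single {#} c * normal_form a p"
  using linear_map_scale[OF linear_map_normal_form, of a c p] by (simp add: scalar_def)

text \<open>The empty multiset is the least exponent, so nothing but a constant can remain.\<close>

lemma scalar_if_leading_empty:
  assumes p: "leading b p {#} c" "p \<in> free_carrier n"
  shows "p - scalar c \<in> relation_ideal n b"
proof -
  have "Poly_Mapping.keys (normal_form b p) \<subseteq> {{#}}"
    using leading_lookup_normal_form(2)[OF p(1)] deglex_size_le by fastforce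
  then have "normal_form b p = Poly_Mapping.single {#} c"
    using leading_lookup_normal_form(1)[OF p(1)]
    by (intro poly_mapping_eqI) (auto simp: lookup_single when_def in_keys_iff)
  then show ?thesis
    using normal_form(1)[OF p(2), of b] by (simp add: scalar_def)
qed

text \<open>
  Each \<open>x\<^sub>j\<close> is a combination of ordered monomials in the \<open>u\<^sub>i\<close> and its leading exponent is one of theirs,
  \<open>{#j#} = \<Sum> m\<^sub>i E\<^sub>i\<close>. As no \<open>E\<^sub>i\<close> is empty, \<open>m\<close> has one element \<open>i\<close>, and \<open>E\<^sub>i = {#j#}\<close>. This
  defines an injection \<open>j \<mapsto> i\<close> of the index set into itself, and \<open>t\<close> is its inverse.
\<close>

lemma leading_exponents_of_generators:
  fixes a b :: "nat \<Rightarrow> nat \<Rightarrow> 'k::field"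
  assumes two: "(2::'k) \<noteq> 0" and n: "even n"
    and u: "\<And>i. i \<in> {1..n} \<Longrightarrow> u i \<in> free_carrier n"
    and ker: "\<And>p. p \<in> free_carrier n \<Longrightarrow> substitute u p \<in> relation_ideal n b \<longleftrightarrow> p \<in> relation_ideal n a"
    and surj: "\<And>q. q \<in> free_carrier n \<Longrightarrow> \<exists>p\<in>free_carrier n. q - substitute u p \<in> relation_ideal n b"
  obtains t c where "t permutes {1..n}" "\<And>i. i \<in> {1..n} \<Longrightarrow> c i \<noteq> 0"
    "\<And>i. i \<in> {1..n} \<Longrightarrow> leading b (u i) {#t i#} (c i)"
proof -
  have nonscalar: "u i - scalar d \<notin> relation_ideal n b" if i: "i \<in> {1..n}" for i d
  proof
    note g = free_carrier_gen[OF i, where 'a = 'k]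
    assume "u i - scalar d \<in> relation_ideal n b"
    then have "gen i - scalar d \<in> relation_ideal n a"
      using ker[of "gen i - scalar d"] g by (simp add: free_carrier_diff substitute_diff)
    from normal_form_ideal[OF this] have "Poly_Mapping.single {#i#} (1::'k) = Poly_Mapping.single {#} d"
      by (simp add: normal_form_diff)
    then have "Poly_Mapping.lookup (Poly_Mapping.single {#i#} (1::'k)) {#i#}
        = Poly_Mapping.lookup (Poly_Mapping.single {#} d) {#i#}" by simp
    then show False by (simp add: lookup_single)
  qed
  have "\<exists>e c. c \<noteq> 0 \<and> leading b (u i) e c" if i: "i \<in> {1..n}" for i
  proof (rule leading_exists[OF u[OF i]])
    show "normal_form b (u i) \<noteq> 0"
      using nonscalar[OF i, of 0] normal_form(1)[OF u[OF i], of b] by (auto simp: scalar_def)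
  qed
  then obtain E c where E: "\<And>i. i \<in> {1..n} \<Longrightarrow> c i \<noteq> 0 \<and> leading b (u i) (E i) (c i)"
    by metis
  have E_nonempty: "E i \<noteq> {#}" if "i \<in> {1..n}" for i
    using nonscalar[OF that] scalar_if_leading_empty[OF _ u[OF that]] E[OF that] by metis
  have odd_lt: "odd (crossings (E i) (E j) + crossings (E j) (E i))"
    if ij: "i \<in> {1..n}" "j \<in> {1..n}" "i < j" for i j
  proof (rule leading_anticommute[where c = "c i" and d = "c j"])
    let ?r = "gen i * gen j + gen j * gen i - scalar (a i j) :: word \<Rightarrow>\<^sub>0 'k"
    have r: "?r \<in> relation_ideal n a" using ij by (intro relation_ideal_relation) auto
    show "u i * u j + u j * u i - scalar (a i j) \<in> relation_ideal n b"
      using ker[OF relation_ideal_carrier[OF r]] r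
      by (simp add: substitute_diff substitute_add substitute_mult)
  qed (use E[OF ij(1)] E[OF ij(2)] E_nonempty[OF ij(1)] two in auto)
  have inj: "inj_on (\<lambda>m. \<Sum>i\<in>#m. E i) {m. set_mset m \<subseteq> {1..n}}"
  proof (rule sum_mset_inj_of_odd_crossings[OF n])
    fix i j assume ij: "i \<in> {1..n}" "j \<in> {1..n}" "i \<noteq> j"
    then show "odd (crossings (E i) (E j) + crossings (E j) (E i))"
      using odd_lt[of i j] odd_lt[of j i] by (cases "i < j") (simp_all add: add.commute)
  qed
  have "\<exists>i\<in>{1..n}. E i = {#j#}" if j: "j \<in> {1..n}" for j
  proof -
    note g = free_carrier_gen[OF j, where 'a = 'k]
    obtain p where p: "p \<in> free_carrier n" "gen j - substitute u p \<in> relation_ideal n b"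
      using surj[OF g] by blast
    have "p \<notin> relation_ideal n a"
    proof
      assume "p \<in> relation_ideal n a"
      then have "substitute u p \<in> relation_ideal n b" using ker[OF p(1)] by simp
      from relation_ideal_add[OF p(2) this] have "normal_form b (gen j) = 0"
        by (intro normal_form_ideal[of _ n]) simp
      then have "Poly_Mapping.keys (normal_form b (gen j)) = {}" by simp
      then show False by simp
    qed
    then have "normal_form a p \<noteq> 0"
      using normal_form(1)[OF p(1), of a] by auto
    then obtain m d where m: "set_mset m \<subseteq> {1..n}" "d \<noteq> 0" "leading b (substitute u p) (\<Sum>i\<in>#m. E i) d"
      using leading_substitute[OF p(1), of a b u E] E ker relation_ideal_carrier inj by metis
    have "leading b (gen j) (\<Sum>i\<in>#m. E i) d"
      using leading_cong[OF _ m(3), of "gen j" n] relation_ideal_uminus[OF p(2)] by simp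
    then have sum: "(\<Sum>i\<in>#m. E i) = {#j#}"
      using leading_unique[OF _ m(2) leading_gen[of b j]] by simp
    then obtain i m' where i: "m = add_mset i m'" by (cases m) auto
    then have "i \<in> {1..n}" "E i + (\<Sum>i\<in>#m'. E i) = {#j#}" using m(1) sum by auto
    moreover from this have "E i = {#j#}"
      using E_nonempty[of i] by (auto simp: union_is_single)
    ultimately show ?thesis by blast
  qed
  then obtain g where g: "\<And>j. j \<in> {1..n} \<Longrightarrow> g j \<in> {1..n} \<and> E (g j) = {#j#}"
    by metis
  have inj_g: "inj_on g {1..n}"
    using g by (metis inj_onI single_eq_single)
  moreover have "g ` {1..n} \<subseteq> {1..n}" using g by blast
  ultimately have bij: "bij_betw g {1..n} {1..n}"
    by (simp add: bij_betw_def endo_inj_surj)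
  define t where "t i = (if i \<in> {1..n} then inv_into {1..n} g i else i)" for i
  have bij_t: "bij_betw (inv_into {1..n} g) {1..n} {1..n}"
    using bij by (rule bij_betw_inv_into)
  have t: "t permutes {1..n}"
  proof (rule bij_imp_permutes)
    show "bij_betw t {1..n} {1..n}"
      using bij_t by (rule bij_betw_cong[THEN iffD1, rotated]) (simp add: t_def)
  qed (auto simp: t_def)
  have "E i = {#t i#}" if i: "i \<in> {1..n}" for i
  proof -
    have "i \<in> g ` {1..n}" using bij i by (simp add: bij_betw_def)
    then have "g (t i) = i" using i by (simp add: t_def f_inv_into_f)
    moreover have "t i \<in> {1..n}" using i permutes_in_image[OF t] by blast
    ultimately show ?thesis using g[of "t i"] by simp
  qed
  with E t show thesis by (intro that[of t c]) auto
qed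

text \<open>In the degree-lexicographic order only exponents of size at most one are below \<open>{#t#}\<close>.\<close>

lemma affine_of_leading_single:
  assumes p: "p \<in> free_carrier n" and lead: "leading b p {#t#} c"
  obtains \<alpha> \<beta> where "p - ((\<Sum>j\<in>{1..n}. scalar (\<alpha> j) * gen j) + scalar \<beta>) \<in> relation_ideal n b"
    "\<alpha> t = c"
proof
  let ?r = "normal_form b p" and ?X = "insert {#} ((\<lambda>j. {#j#}) ` {1..n})"
  have "e \<in> ?X" if e: "e \<in> Poly_Mapping.keys ?r" for e
  proof -
    have "size e \<le> 1" using deglex_size_le[OF leading_lookup_normal_form(2)[OF lead e]] by simp
    then have "e = {#} \<or> (\<exists>j. e = {#j#})"
      by (cases e) auto
    then show ?thesis using normal_form(2)[OF p e] by auto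
  qed
  then have "linear_extension ordered_monomial ?r
      = (\<Sum>e\<in>?X. Poly_Mapping.single 0 (Poly_Mapping.lookup ?r e) * ordered_monomial e)"
    by (intro linear_extension_superset) auto
  also have "\<dots> = scalar (Poly_Mapping.lookup ?r {#}) + (\<Sum>j\<in>{1..n}. scalar (Poly_Mapping.lookup ?r {#j#}) * ordered_monomial {#j#})"
    by (subst sum.insert) (auto simp: sum.reindex inj_on_def scalar_def)
  also have "\<dots> = (\<Sum>j\<in>{1..n}. scalar (Poly_Mapping.lookup ?r {#j#}) * gen j) + scalar (Poly_Mapping.lookup ?r {#})"
    using ordered_monomial_add_mset[of "{#}", where 'a = 'a] by (simp add: add.commute)
  finally show "p - ((\<Sum>j\<in>{1..n}. scalar (Poly_Mapping.lookup ?r {#j#}) * gen j) + scalar (Poly_Mapping.lookup ?r {#}))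
      \<in> relation_ideal n b"
    using normal_form(1)[OF p, of b] by simp
  show "Poly_Mapping.lookup ?r {#t#} = c" by (rule leading_lookup_normal_form(1)[OF lead])
qed

lemma relation_ideal_anticommutator_cong:
  assumes "p - p' \<in> relation_ideal n b" "q - q' \<in> relation_ideal n b"
    and "p \<in> free_carrier n" "p' \<in> free_carrier n" "q \<in> free_carrier n" "q' \<in> free_carrier n"
    and "p * q + q * p - r \<in> relation_ideal n b"
  shows "p' * q' + q' * p' - r \<in> relation_ideal n b"
proof -
  have "(p - p') * q + p' * (q - q') + (q - q') * p + q' * (p - p') \<in> relation_ideal n b"
    using assms by (intro relation_ideal_add relation_ideal_mult_left relation_ideal_mult_right)
  from relation_ideal_diff[OF assms(7) this] show ?thesis
    by (simp add: algebra_simps)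
qed

lemma lookup_single_empty_mult:
  "Poly_Mapping.lookup (Poly_Mapping.single {#} c * m) (e :: 'b multiset) = (c :: 'k::field) * Poly_Mapping.lookup m e"
  using lookup_scalar_mult[of c m e] by simp

text \<open>
  The coefficient of \<open>x\<^sub>r\<^sup>2\<close> in a product of two generators: contractions only produce constants, and
  sorting two different letters does not produce a square.
\<close>

lemma lookup_gen_action_single:
  "Poly_Mapping.lookup (gen_action b j (Poly_Mapping.single {#k#} x)) {#r, r#} = (if j = r \<and> k = r then x else 0)"
proof -
  have "Poly_Mapping.lookup (lower l (Poly_Mapping.single {#k#} x)) {#r, r#} = 0" for l
    by (simp add: lower_single lookup_single)
  moreover have "Poly_Mapping.lookup (raise j (Poly_Mapping.single {#k#} x)) {#r, r#} = (if j = r \<and> k = r then x else 0)"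
    by (auto simp: lookup_single when_def add_eq_conv_ex)
  ultimately show ?thesis
    by (simp add: gen_action_def lookup_add lookup_sum lookup_single_empty_mult)
qed

lemma lookup_gen_action_empty:
  "Poly_Mapping.lookup (gen_action b j (Poly_Mapping.single {#} x)) {#r, r#} = 0"
  by (simp add: gen_action_def lookup_single)

lemma lookup_normal_form_affine_mult:
  assumes r: "r \<in> {1..n}"
  shows "Poly_Mapping.lookup (normal_form b
     (((\<Sum>j\<in>{1..n}. scalar (\<alpha> j) * gen j) + scalar \<beta>) * ((\<Sum>j\<in>{1..n}. scalar (\<alpha>' j) * gen j) + scalar \<beta>'))) {#r, r#}
     = \<alpha> r * \<alpha>' r"
    (is "Poly_Mapping.lookup (normal_form b (?p * ?q)) _ = _")
proof -
  define m where "m = normal_form b ?q"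
  have m: "m = (\<Sum>k\<in>{1..n}. Poly_Mapping.single {#k#} (\<alpha>' k)) + Poly_Mapping.single {#} \<beta>'"
    by (simp add: m_def normal_form_add normal_form_sum normal_form_scale)
  have left: "Poly_Mapping.lookup (gen_action b j m) {#r, r#} = (if j = r then \<alpha>' r else 0)" for j
    using r unfolding m linear_map_add[OF linear_map_gen_action] linear_map_sum[OF linear_map_gen_action]
    by (auto simp: lookup_add lookup_sum lookup_gen_action_single lookup_gen_action_empty sum.delta)
  have "Poly_Mapping.lookup m {#r, r#} = 0"
    by (simp add: m lookup_add lookup_sum lookup_single)
  moreover have "normal_form b (?p * ?q) = (\<Sum>j\<in>{1..n}. Poly_Mapping.single {#} (\<alpha> j) * gen_action b j m)
      + Poly_Mapping.single {#} \<beta> * m"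
    unfolding m_def normal_form_def
    by (simp add: represent_mult linear_map_gen_action represent_add represent_sum)
  ultimately show ?thesis
    using r by (simp add: lookup_add lookup_sum lookup_single_empty_mult left if_distrib sum.delta cong: if_cong)
qed

lemma affine_mult:
  "(scalar l * p + scalar \<beta>) * (scalar m * q + scalar \<gamma>)
   = scalar (l * m) * (p * q) + scalar (l * \<gamma>) * p + scalar (\<beta> * m) * q + scalar (\<beta> * \<gamma>)"
proof -
  have "scalar l * p * scalar \<gamma> = scalar (l * \<gamma>) * p"
    using scalar_mult_scalar_mult[of l p \<gamma> 1] by simp
  moreover have "scalar \<beta> * (scalar m * q) = scalar (\<beta> * m) * q"
    by (simp add: scalar_mult flip: mult.assoc)
  ultimately show ?thesis
    by (simp add: distrib_left distrib_right scalar_mult_scalar_mult scalar_mult)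
qed

text \<open>
  After subtracting a multiple of the relation between \<open>x\<^sub>s\<close> and \<open>x\<^sub>t\<close> only terms of degree at most one
  remain, and their coefficients vanish.
\<close>

lemma rescaled_of_affine_relation:
  fixes b :: "nat \<Rightarrow> nat \<Rightarrow> 'k::field"
  assumes b: "\<And>i j. 1 \<le> j \<Longrightarrow> j < i \<Longrightarrow> i \<le> n \<Longrightarrow> b i j = b j i"
    and st: "s \<in> {1..n}" "t \<in> {1..n}" "s \<noteq> t"
    and rel: "(scalar l * gen s + scalar \<beta>) * (scalar m * gen t + scalar \<gamma>)
      + (scalar m * gen t + scalar \<gamma>) * (scalar l * gen s + scalar \<beta>) - scalar x \<in> relation_ideal n b"
  shows "2 * (\<beta> * m) = 0" and "x = l * m * b s t + 2 * (\<beta> * \<gamma>)"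
proof -
  let ?rest = "scalar (l * m * b s t) + scalar (l * \<gamma>) * gen s + scalar (\<beta> * m) * gen t + scalar (\<beta> * \<gamma>)
      + scalar (m * \<beta>) * gen t + scalar (\<gamma> * l) * gen s + scalar (\<gamma> * \<beta>) - scalar x"
  have "scalar (l * m) * (gen s * gen t + gen t * gen s - scalar (b s t)) \<in> relation_ideal n b"
    by (rule relation_ideal_mult_left[OF relation_ideal_relation'[OF b st] free_carrier_scalar])
  from relation_ideal_diff[OF rel this] have "?rest \<in> relation_ideal n b"
    unfolding affine_mult by (simp add: scalar_mult mult.commute[of m l] algebra_simps)
  from normal_form_ideal[OF this] have nf: "normal_form b ?rest = 0" .
  have "Poly_Mapping.lookup (normal_form b ?rest) {#t#} = \<beta> * m + m * \<beta>"
    using st(3) by (simp add: normal_form_add normal_form_diff normal_form_scale lookup_add lookup_minus lookup_single)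
  then show "2 * (\<beta> * m) = 0" unfolding nf by (simp only: lookup_zero mult_2 mult.commute[of m])
  have "Poly_Mapping.lookup (normal_form b ?rest) {#} = l * m * b s t + \<beta> * \<gamma> + \<gamma> * \<beta> - x"
    by (simp add: normal_form_add normal_form_diff normal_form_scale lookup_add lookup_minus lookup_single)
  then show "x = l * m * b s t + 2 * (\<beta> * \<gamma>)" unfolding nf by (simp add: algebra_simps)
qed

text \<open>
  Each \<open>u\<^sub>i\<close> is an affine form \<open>v\<^sub>i\<close> in the generators. The supports of their linear parts are
  disjoint, because the coefficient of \<open>x\<^sub>r\<^sup>2\<close> in the anticommutator of \<open>v\<^sub>i\<close> and \<open>v\<^sub>j\<close> is
  \<open>2 \<alpha>\<^sub>i\<^sub>r \<alpha>\<^sub>j\<^sub>r\<close>, and the support of \<open>v\<^sub>i\<close> contains \<open>t i\<close>; so it is \<open>{t i}\<close>. The constant parts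
  vanish since the anticommutator with any other \<open>v\<^sub>j\<close> has no linear term.
\<close>

lemma rescaled_if_algebra_isomorphic:
  fixes a b :: "nat \<Rightarrow> nat \<Rightarrow> 'k::field"
  assumes two: "(2::'k) \<noteq> 0" and n: "even n" "n \<ge> 2"
    and a: "\<And>i j. 1 \<le> j \<Longrightarrow> j < i \<Longrightarrow> i \<le> n \<Longrightarrow> a i j = a j i"
    and b: "\<And>i j. 1 \<le> j \<Longrightarrow> j < i \<Longrightarrow> i \<le> n \<Longrightarrow> b i j = b j i"
    and iso: "algebra_isomorphic (V_algebra n a) (V_algebra n b)"
  shows "\<exists>t l. t permutes {1..n} \<and> (\<forall>i\<in>{1..n}. l i \<noteq> 0) \<and>
    (\<forall>i\<in>{1..n}. \<forall>j\<in>{1..n}. i \<noteq> j \<longrightarrow> a i j = l i * l j * b (t i) (t j))"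
proof -
  obtain u where u: "\<And>i. i \<in> {1..n} \<Longrightarrow> u i \<in> free_carrier n"
    and ker: "\<And>p. p \<in> free_carrier n \<Longrightarrow> substitute u p \<in> relation_ideal n b \<longleftrightarrow> p \<in> relation_ideal n a"
    and surj: "\<And>q. q \<in> free_carrier n \<Longrightarrow> \<exists>p\<in>free_carrier n. q - substitute u p \<in> relation_ideal n b"
    using iso unfolding algebra_isomorphic_iff_substitution by blast
  obtain t l where t: "t permutes {1..n}" and l: "\<And>i. i \<in> {1..n} \<Longrightarrow> l i \<noteq> 0"
    and lead: "\<And>i. i \<in> {1..n} \<Longrightarrow> leading b (u i) {#t i#} (l i)"
    using leading_exponents_of_generators[OF two n(1) u ker surj] by metis
  have t_in: "t i \<in> {1..n}" if "i \<in> {1..n}" for i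
    using that permutes_in_image[OF t] by blast
  have "\<exists>\<alpha> \<beta>. u i - ((\<Sum>j\<in>{1..n}. scalar (\<alpha> j) * gen j) + scalar \<beta>) \<in> relation_ideal n b \<and> \<alpha> (t i) = l i"
    if "i \<in> {1..n}" for i
    using affine_of_leading_single[OF u[OF that] lead[OF that]] by metis
  then obtain \<alpha> \<beta> where affine: "\<And>i. i \<in> {1..n} \<Longrightarrow>
        u i - ((\<Sum>j\<in>{1..n}. scalar (\<alpha> i j) * gen j) + scalar (\<beta> i)) \<in> relation_ideal n b"
    and \<alpha>_lead: "\<And>i. i \<in> {1..n} \<Longrightarrow> \<alpha> i (t i) = l i"
    by metis
  define v where "v i = (\<Sum>j\<in>{1..n}. scalar (\<alpha> i j) * gen j) + scalar (\<beta> i)" for i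
  have v: "v i \<in> free_carrier n" for i
    unfolding v_def by (intro free_carrier_intros free_carrier_scalar)
  have rel: "v i * v j + v j * v i - scalar (a i j) \<in> relation_ideal n b"
    if ij: "i \<in> {1..n}" "j \<in> {1..n}" "i \<noteq> j" for i j
  proof -
    let ?r = "gen i * gen j + gen j * gen i - scalar (a i j) :: word \<Rightarrow>\<^sub>0 'k"
    have r: "?r \<in> relation_ideal n a" by (rule relation_ideal_relation'[OF a ij])
    have "u i * u j + u j * u i - scalar (a i j) \<in> relation_ideal n b"
      using ker[OF relation_ideal_carrier[OF r]] r
      by (simp add: substitute_diff substitute_add substitute_mult)
    then show ?thesis
      by (rule relation_ideal_anticommutator_cong[OF affine[OF ij(1), folded v_def] affine[OF ij(2), folded v_def]
            u[OF ij(1)] v u[OF ij(2)] v])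
  qed
  have disjoint: "\<alpha> i r * \<alpha> j r = 0" if ij: "i \<in> {1..n}" "j \<in> {1..n}" "i \<noteq> j" and r: "r \<in> {1..n}" for i j r
  proof -
    have "Poly_Mapping.lookup (normal_form b (v i * v j + v j * v i - scalar (a i j))) {#r, r#}
        = \<alpha> i r * \<alpha> j r + \<alpha> j r * \<alpha> i r"
      by (simp add: normal_form_add normal_form_diff lookup_add lookup_minus lookup_single
          lookup_normal_form_affine_mult[OF r] v_def del: One_nat_def)
    then have "2 * (\<alpha> i r * \<alpha> j r) = 0"
      unfolding normal_form_ideal[OF rel[OF ij]] by (simp only: lookup_zero mult_2 mult.commute[of "\<alpha> j r"])
    with two show ?thesis by simp
  qed
  have v_eq: "v i = scalar (l i) * gen (t i) + scalar (\<beta> i)" if i: "i \<in> {1..n}" for i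
  proof -
    have "\<alpha> i r = 0" if r: "r \<in> {1..n} - {t i}" for r
    proof -
      obtain j where j: "j \<in> {1..n}" "r = t j"
        using r permutes_image[OF t] by blast
      with r disjoint[of i j r] i \<alpha>_lead[of j] l[of j] show ?thesis by auto
    qed
    then have "(\<Sum>j\<in>{1..n}. scalar (\<alpha> i j) * gen j) = (\<Sum>j\<in>{t i}. scalar (\<alpha> i j) * gen j)"
      using t_in[OF i] by (intro sum.mono_neutral_right) (auto simp: scalar_def)
    then show ?thesis by (simp add: v_def \<alpha>_lead[OF i])
  qed
  have t_neq: "t i \<noteq> t j" if "i \<noteq> j" for i j
    using that by (simp add: inj_eq[OF permutes_inj[OF t]])
  have \<beta>: "\<beta> i = 0" if i: "i \<in> {1..n}" for i
  proof -
    \<comment> \<open>Here \<open>n \<ge> 2\<close> is needed: some index is different from \<open>i\<close>.\<close>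
    define j :: nat where "j = (if i = 1 then 2 else 1)"
    have j: "j \<in> {1..n}" "i \<noteq> j" using n(2) by (auto simp: j_def)
    have "2 * (\<beta> i * l j) = 0"
      by (rule rescaled_of_affine_relation(1)[where b = b,
            OF b t_in[OF i] t_in[OF j(1)] t_neq[OF j(2)] rel[OF i j, unfolded v_eq[OF i] v_eq[OF j(1)]]])
    with two l[OF j(1)] show ?thesis by simp
  qed
  have "a i j = l i * l j * b (t i) (t j)" if ij: "i \<in> {1..n}" "j \<in> {1..n}" "i \<noteq> j" for i j
  proof -
    have "a i j = l i * l j * b (t i) (t j) + 2 * (\<beta> i * \<beta> j)"
      by (rule rescaled_of_affine_relation(2)[where b = b,
            OF b t_in[OF ij(1)] t_in[OF ij(2)] t_neq[OF ij(3)] rel[OF ij, unfolded v_eq[OF ij(1)] v_eq[OF ij(2)]]])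
    then show ?thesis using \<beta>[OF ij(1)] by simp
  qed
  then show ?thesis by (intro exI[of _ t] exI[of _ l] conjI ballI impI t l)
qed

section \<open>Classification up to isomorphism\<close>

theorem theorem3:
  fixes a a' :: "nat \<Rightarrow> nat \<Rightarrow> 'k::field" and n :: nat
  assumes "CHAR('k) \<noteq> 2"
    and "n \<ge> 2" and "even n"
    and "\<And>i j. 1 \<le> j \<Longrightarrow> j < i \<Longrightarrow> i \<le> n \<Longrightarrow> a i j = a j i"
    and "\<And>i j. 1 \<le> j \<Longrightarrow> j < i \<Longrightarrow> i \<le> n \<Longrightarrow> a' i j = a' j i"
  shows "algebra_isomorphic (V_algebra n a) (V_algebra n a') \<longleftrightarrow>
    (\<exists>(\<sigma> :: nat \<Rightarrow> nat) (l :: nat \<Rightarrow> 'k). \<sigma> permutes {1..n} \<and> (\<forall>i\<in>{1..n}. l i \<noteq> 0) \<and>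
      (\<forall>i\<in>{1..n}. \<forall>j\<in>{1..n}. i \<noteq> j \<longrightarrow> a' i j = l i * l j * a (\<sigma> i) (\<sigma> j)))"
    (is "?iso \<longleftrightarrow> ?rescaled")
proof
  assume ?rescaled
  then obtain \<sigma> and l :: "nat \<Rightarrow> 'k" where s: "\<sigma> permutes {1..n}" and l: "\<And>i. i \<in> {1..n} \<Longrightarrow> l i \<noteq> 0"
    and eq: "\<And>i j. i \<in> {1..n} \<Longrightarrow> j \<in> {1..n} \<Longrightarrow> i \<noteq> j \<Longrightarrow> a' i j = l i * l j * a (\<sigma> i) (\<sigma> j)"
    by blast
  show ?iso
    by (rule algebra_isomorphic_if_rescaled[where a = a and b = a' and s = \<sigma> and l = l,
          OF assms(4,5) s l eq])
next
  assume iso: ?iso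
  have two: "(2::'k) \<noteq> 0"
  proof
    assume "(2::'k) = 0"
    then have "of_nat 2 = (0::'k)" by simp
    then have dvd: "CHAR('k) dvd 2" by (simp only: of_nat_eq_0_iff_char_dvd)
    then have "CHAR('k) \<noteq> 0" by (intro notI) simp
    moreover from dvd have "CHAR('k) \<le> 2" by (rule dvd_imp_le) simp
    ultimately show False using assms(1) CHAR_not_1[where 'a = 'k] by linarith
  qed
  obtain t l where t: "t permutes {1..n}" and l: "\<And>i. i \<in> {1..n} \<Longrightarrow> l i \<noteq> 0"
    and a: "\<And>i j. i \<in> {1..n} \<Longrightarrow> j \<in> {1..n} \<Longrightarrow> i \<noteq> j \<Longrightarrow> a i j = l i * l j * a' (t i) (t j)"
  proof -
    have "\<exists>t l. t permutes {1..n} \<and> (\<forall>i\<in>{1..n}. l i \<noteq> 0) \<and>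
        (\<forall>i\<in>{1..n}. \<forall>j\<in>{1..n}. i \<noteq> j \<longrightarrow> a i j = l i * l j * a' (t i) (t j))"
      by (rule rescaled_if_algebra_isomorphic[where a = a and b = a', OF two assms(3,2,4,5) iso])
    then show thesis using that by blast
  qed
  let ?s = "inv_into UNIV t"
  let ?l = "\<lambda>i. inverse (l (?s i))"
  have s: "?s permutes {1..n}" by (rule permutes_inv[OF t])
  have ts: "t (?s i) = i" for i by (rule permutes_inverses[OF t])
  have s_in: "?s i \<in> {1..n}" if "i \<in> {1..n}" for i
    using that permutes_in_image[OF s] by blast
  have eq: "a' i j = ?l i * ?l j * a (?s i) (?s j)" if ij: "i \<in> {1..n}" "j \<in> {1..n}" "i \<noteq> j" for i j
  proof -
    have "?s i \<noteq> ?s j" using ij(3) ts by metis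
    then have "a (?s i) (?s j) = l (?s i) * l (?s j) * a' i j"
      using a[OF s_in[OF ij(1)] s_in[OF ij(2)]] by (simp add: ts)
    then show ?thesis
      using l[OF s_in[OF ij(1)]] l[OF s_in[OF ij(2)]] by (simp add: field_simps)
  qed
  have nz: "?l i \<noteq> 0" if "i \<in> {1..n}" for i
    using l[OF s_in[OF that]] by simp
  show ?rescaled
    by (intro exI[of _ ?s] exI[of _ ?l] conjI ballI impI s nz eq)
qed

end
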